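(* Let $\mathbb{F}$ be an infinite field, let $I,J,K$ be finite sets and $\Lambda\subseteq I\times J\times K$ nonempty. If $P$ is a probability distribution on $\Lambda$ and $a,b,c\ge0$ satisfy $a\le H(I)_P$, $b\le H(J)_P$, $c\le H(K)_P$, $a+b\le H(IJ)_P$, $a+c\le H(IK)_P$, $b+c\le H(JK)_P$, $a+b+c\le H(IJK)_P$, then $$\omega_s(a,b,c)\le\log\underset{\sim}{R}_s(\langle\Lambda\rangle)\le\log\underline{R}_s(\langle\Lambda\rangle)\le\log R_s(\langle\Lambda\rangle).$$ Consequently, $$\omega_s\le3\,\frac{\log R_s(\langle\Lambda\rangle)}{\log|\Lambda|}.$$
   Context: Logarithms are base 2. A tensor over $\mathbb{F}$ is a trilinear form $T=\sum t_{a,b,c}x_ay_bz_c$ with variables indexed by finite sets; its support is $\{(a,b,c):t_{a,b,c}\ne0\}$; its rank $R(T)$ is the minimal number of products of three linear forms (one in each set of variables) summing to $T$; its border rank $\underline{R}(T)$ is the smallest $r$ with $T$ in the closure of the tensors of rank $\le r$ (over the algebraic closure). For a support $\Phi$, $R_s(\Phi)=\min\{R(T):\operatorname{supp}T=\Phi\}$ and $\underline{R}_s(\Phi)=\min\{\underline{R}(T):\operatorname{supp}T=\Phi\}$; with $\Phi^n$ the $n$-fold product of supports (regrouping factors), the asymptotic support rank is $\underset{\sim}{R}_s(\Phi)=\lim_n R_s(\Phi^n)^{1/n}=\inf_n R_s(\Phi^n)^{1/n}=\lim_n\underline{R}_s(\Phi^n)^{1/n}$. For $\Lambda\subseteq I\times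 J\times K$, $\langle\Lambda\rangle=\{((i,j),(j,k),(k,i)):(i,j,k)\in\Lambda\}$, the support of $\sum_{(i,j,k)\in\Lambda}x_{i,j}y_{j,k}z_{k,i}$. The matrix multiplication tensor is $\langle l,m,n\rangle=\sum_{i\le l,j\le m,k\le n}x_{i,j}y_{j,k}z_{k,i}$. Define $\omega_s(a,b,c)=\lim_{n\to\infty}\frac1n\log R_s(\operatorname{supp}\langle\lfloor2^{an}\rfloor,\lfloor2^{bn}\rfloor,\lfloor2^{cn}\rfloor\rangle)$ and $\omega_s=\omega_s(1,1,1)=\log\underset{\sim}{R}_s(\operatorname{supp}\langle2,2,2\rangle)$ (the support rank exponent of matrix multiplication). For a probability distribution $P$ on $\Lambda$, $H(I)_P$, $H(IJ)_P$, etc. are the Shannon entropies of the marginals of $P$ on $I$, $I\times J$, etc., and $H(IJK)_P=H(P)$. *)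

theory Defs
  imports "HOL-Analysis.Analysis" "HOL-Algebra.Algebraic_Closure_Type"
begin

text \<open>A tensor with x-variables indexed by 'a, y-variables by 'b, z-variables by 'c
  is its coefficient function; only finitely supported tensors are used.\<close>

definition tsupp :: "('a \<times> 'b \<times> 'c \<Rightarrow> 'k::zero) \<Rightarrow> ('a \<times> 'b \<times> 'c) set" where
  "tsupp T = {x. T x \<noteq> 0}"

definition rank_le :: "nat \<Rightarrow> ('a \<times> 'b \<times> 'c \<Rightarrow> 'k::comm_semiring_1) \<Rightarrow> bool" where
  "rank_le r T \<longleftrightarrow> (\<exists>u v w. \<forall>a b c. T (a, b, c) = (\<Sum>l<r. u l a * v l b * w l c))"

inductive_set polyfun :: "('a \<times> 'b \<times> 'c) set \<Rightarrow> (('a \<times> 'b \<times> 'c \<Rightarrow> 'k::comm_ring_1) \<Rightarrow> 'k) set"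
  for D where
  const: "(\<lambda>T. c) \<in> polyfun D"
| coord: "x \<in> D \<Longrightarrow> (\<lambda>T. T x) \<in> polyfun D"
| add: "p \<in> polyfun D \<Longrightarrow> q \<in> polyfun D \<Longrightarrow> (\<lambda>T. p T + q T) \<in> polyfun D"
| mult: "p \<in> polyfun D \<Longrightarrow> q \<in> polyfun D \<Longrightarrow> (\<lambda>T. p T * q T) \<in> polyfun D"

definition zariski_closure ::
  "('a \<times> 'b \<times> 'c) set \<Rightarrow> ('a \<times> 'b \<times> 'c \<Rightarrow> 'k::comm_ring_1) set \<Rightarrow> ('a \<times> 'b \<times> 'c \<Rightarrow> 'k) set" where
  "zariski_closure D S = {T. (\<forall>x. x \<notin> D \<longrightarrow> T x = 0) \<and>
     (\<forall>p\<in>polyfun D. (\<forall>s\<in>S. p s = 0) \<longrightarrow> p T = 0)}"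

definition border_rank_le ::
  "('a \<times> 'b \<times> 'c) set \<Rightarrow> nat \<Rightarrow> ('a \<times> 'b \<times> 'c \<Rightarrow> 'k::field) \<Rightarrow> bool" where
  "border_rank_le D r T \<longleftrightarrow>
     (to_ac \<circ> T) \<in> zariski_closure D {S. (\<forall>x. x \<notin> D \<longrightarrow> S x = 0) \<and> rank_le r S}"

definition supp_dom :: "('a \<times> 'b \<times> 'c) set \<Rightarrow> ('a \<times> 'b \<times> 'c) set" where
  "supp_dom \<Phi> = (fst ` \<Phi>) \<times> ((fst \<circ> snd) ` \<Phi>) \<times> ((snd \<circ> snd) ` \<Phi>)"

definition support_rank :: "'k::field itself \<Rightarrow> ('a \<times> 'b \<times> 'c) set \<Rightarrow> nat" where
  "support_rank F \<Phi> = (LEAST r. \<exists>T :: 'a \<times> 'b \<times> 'c \<Rightarrow> 'k. tsupp T = \<Phi> \<and> rank_le r T)"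

definition border_support_rank :: "'k::field itself \<Rightarrow> ('a \<times> 'b \<times> 'c) set \<Rightarrow> nat" where
  "border_support_rank F \<Phi> =
     (LEAST r. \<exists>T :: 'a \<times> 'b \<times> 'c \<Rightarrow> 'k. tsupp T = \<Phi> \<and> border_rank_le (supp_dom \<Phi>) r T)"

text \<open>n-fold product of a support, factors regrouped: indices become length-n lists.\<close>
definition supp_pow :: "nat \<Rightarrow> ('a \<times> 'b \<times> 'c) set \<Rightarrow> ('a list \<times> 'b list \<times> 'c list) set" where
  "supp_pow n \<Phi> = {(as, bs, cs). length as = n \<and> length bs = n \<and> length cs = n \<and>
      (\<forall>l<n. (as ! l, bs ! l, cs ! l) \<in> \<Phi>)}"

definition asymp_support_rank :: "'k::field itself \<Rightarrow> ('a \<times> 'b \<times> 'c) set \<Rightarrow> real" where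
  "asymp_support_rank F \<Phi> =
     (INF n\<in>{1::nat..}. real (support_rank F (supp_pow n \<Phi>)) powr (1 / real n))"

definition mm_supp :: "('i \<times> 'j \<times> 'k) set \<Rightarrow> (('i \<times> 'j) \<times> ('j \<times> 'k) \<times> ('k \<times> 'i)) set" where
  "mm_supp \<Lambda> = {((i, j), (j, k), (k, i)) | i j k. (i, j, k) \<in> \<Lambda>}"

definition mm_box :: "nat \<Rightarrow> nat \<Rightarrow> nat \<Rightarrow> (nat \<times> nat \<times> nat) set" where
  "mm_box l m n = {1..l} \<times> {1..m} \<times> {1..n}"

definition omega_s_abc :: "'k::field itself \<Rightarrow> real \<Rightarrow> real \<Rightarrow> real \<Rightarrow> real" where
  "omega_s_abc F a b c = lim (\<lambda>n::nat. log 2 (real (support_rank F (mm_supp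
      (mm_box (nat \<lfloor>2 powr (a * real n)\<rfloor>) (nat \<lfloor>2 powr (b * real n)\<rfloor>) (nat \<lfloor>2 powr (c * real n)\<rfloor>))))) / real n)"

definition omega_s :: "'k::field itself \<Rightarrow> real" where
  "omega_s F = log 2 (asymp_support_rank F (mm_supp (mm_box 2 2 2)))"

definition marg_entropy :: "'x set \<Rightarrow> ('x \<Rightarrow> real) \<Rightarrow> ('x \<Rightarrow> 'y) \<Rightarrow> real" where
  "marg_entropy \<Lambda> P f =
     - (\<Sum>y\<in>f ` \<Lambda>. (\<Sum>x\<in>{x\<in>\<Lambda>. f x = y}. P x) * log 2 (\<Sum>x\<in>{x\<in>\<Lambda>. f x = y}. P x))"

end

theory Submission
  imports Defs "HOL-Real_Asymp.Real_Asymp"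
begin

text \<open>
  Identifying variables, \<open>x\<^bsub>ij\<^esub> \<mapsto> x\<^bsub>f(i)g(j)\<^esub>\<close> and so on, maps \<open>\<langle>\<Lambda>\<^sup>n\<rangle>\<close> onto the support \<open>\<langle>\<Lambda>'\<rangle>\<close>, where
  \<open>\<Lambda>'\<close> is the image of \<open>\<Lambda>\<^sup>n\<close> under \<open>(f, g, h)\<close>; over an infinite field this does not increase the
  support rank, because a generic rescaling of the variables prevents cancellation. For random
  \<open>f, g, h\<close> with ranges of size \<open>2\<^bsup>an\<^esup>, 2\<^bsup>bn\<^esup>, 2\<^bsup>cn\<^esup>\<close> the second moment method, applied to typical sequences of
  \<open>P\<close>, shows that each point of the box is hit with probability at least \<open>2\<^bsup>-o(n)\<^esup>\<close>; this is where the
  seven entropy inequalities enter. Hence \<open>2\<^bsup>o(n)\<^esup>\<close> such images cover the box, and the support rank is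
  subadditive under unions.

  If \<open>T\<close> lies in the Zariski closure of the tensors of rank at most \<open>r\<close>, then \<open>T\<^sup>\<otimes>\<^sup>n\<close> lies in the span of
  the \<open>s\<^sup>\<otimes>\<^sup>n\<close> with \<open>s\<close> of rank at most \<open>r\<close>. That span has dimension polynomial in \<open>n\<close>, so the rank of
  \<open>T\<^sup>\<otimes>\<^sup>n\<close> is at most \<open>r\<^sup>n\<close> up to a polynomial factor.

  The bound on \<open>\<omega>\<^sub>s\<close> follows by taking \<open>P\<close> uniform and symmetrising \<open>\<langle>l, m, n\<rangle>\<close> cyclically.
\<close>

subsection \<open>Rank and support rank\<close>

text \<open>Every image lies inside the box support by construction, so the only question is how
  many are needed. Let S be a set of factors among I, J, K. Two sequences agreeing exactly on S hit
  a given point together more often than independent ones would, by the product of the range sizes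
  over S. A random sequence agrees on S with a typical one with probability about 2^(-n H(S)). The
  entropy inequality for S says that these two effects cancel; with the trivial case of empty S
  there are eight cases in all. Sequences are weighted by the product measure and not counted by
  type, so P may be any real distribution and only upper deviations have to be excluded. For border
  rank the obstacle is the field: the closure is taken over the algebraic closure, but the
  decomposition is wanted over F. Linear duality over F turns a failure into a polynomial with
  coefficients in F that vanishes on the F-tensors of rank at most r. As F is infinite, it also
  vanishes on the tensors of rank at most r over the closure, hence at T.\<close>

lemma rank_leI_finite:
  assumes "finite S"
    and "\<And>a b c. T (a, b, c) = (\<Sum>l\<in>S. u l a * v l b * w l c)"
  shows "rank_le (card S) T"
proof -
  obtain e where e: "bij_betw e {..<card S} S"
    using ex_bij_betw_nat_finite[OF assms(1)] by (auto simp: atLeast0LessThan)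
  have "T (a, b, c) = (\<Sum>l<card S. u (e l) a * v (e l) b * w (e l) c)" for a b c
    unfolding assms(2)
    using sum.reindex_bij_betw[OF e, of "\<lambda>l. u l a * v l b * w l c"] by simp
  then show ?thesis
    unfolding rank_le_def by (intro exI[of _ "\<lambda>l. u (e l)"] exI[of _ "\<lambda>l. v (e l)"]
        exI[of _ "\<lambda>l. w (e l)"]) blast
qed

lemma rank_le_prod:
  assumes "rank_le r (S :: 'a \<times> 'b \<times> 'c \<Rightarrow> 'f::comm_semiring_1)" "rank_le s T"
    and "\<And>a b c. Z (a, b, c) = S (f a, g b, h c) * T (f' a, g' b, h' c)"
  shows "rank_le (r * s) Z"
proof -
  obtain u v w where S: "\<And>a b c. S (a, b, c) = (\<Sum>l<r. u l a * v l b * w l c)"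
    using assms(1) unfolding rank_le_def by blast
  obtain u' v' w' where T: "\<And>a b c. T (a, b, c) = (\<Sum>l<s. u' l a * v' l b * w' l c)"
    using assms(2) unfolding rank_le_def by blast
  have Z: "Z (a, b, c) = (\<Sum>(l, l')\<in>{..<r} \<times> {..<s}. (u l (f a) * v l (g b) * w l (h c))
      * (u' l' (f' a) * v' l' (g' b) * w' l' (h' c)))" for a b c
    by (simp add: assms(3) S T sum_product sum.cartesian_product)
  have "rank_le (card ({..<r} \<times> {..<s})) Z"
    by (rule rank_leI_finite[where u = "\<lambda>(l, l') a. u l (f a) * u' l' (f' a)"
          and v = "\<lambda>(l, l') b. v l (g b) * v' l' (g' b)"
          and w = "\<lambda>(l, l') c. w l (h c) * w' l' (h' c)"])
      (auto simp: Z mult_ac intro!: sum.cong)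
  then show ?thesis by simp
qed

lemma rank_le_lincomb:
  assumes "\<And>i. i < N \<Longrightarrow> rank_le r (S i)"
    and "\<And>a b c. Z (a, b, c) = (\<Sum>i<N. \<mu> i * S i (a, b, c))"
  shows "rank_le (N * r) Z"
proof -
  have "\<forall>i\<in>{..<N}. \<exists>d. \<forall>a b c. S i (a, b, c)
      = (\<Sum>l<r. fst d l a * fst (snd d) l b * snd (snd d) l c)"
  proof
    fix i assume "i \<in> {..<N}"
    then obtain u v w where "\<forall>a b c. S i (a, b, c) = (\<Sum>l<r. u l a * v l b * w l c)"
      using assms(1)[of i] unfolding rank_le_def by auto
    then show "\<exists>d. \<forall>a b c. S i (a, b, c) = (\<Sum>l<r. fst d l a * fst (snd d) l b * snd (snd d) l c)"
      by (intro exI[of _ "(u, v, w)"]) simp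
  qed
  from bchoice[OF this] obtain d where d: "\<And>i a b c. i < N \<Longrightarrow> S i (a, b, c)
      = (\<Sum>l<r. fst (d i) l a * fst (snd (d i)) l b * snd (snd (d i)) l c)"
    by auto
  define u v w where "u i = fst (d i)" and "v i = fst (snd (d i))" and "w i = snd (snd (d i))" for i
  note d = d[folded u_def v_def w_def]
  have Z: "Z (a, b, c) = (\<Sum>(i, l)\<in>{..<N} \<times> {..<r}. \<mu> i * (u i l a * v i l b * w i l c))" for a b c
    by (simp add: assms(2) d sum_distrib_left sum.cartesian_product[symmetric])
  have "rank_le (card ({..<N} \<times> {..<r})) Z"
    by (rule rank_leI_finite[where u = "\<lambda>(i, l) a. \<mu> i * u i l a"
          and v = "\<lambda>(i, l). v i l" and w = "\<lambda>(i, l). w i l"])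
      (auto simp: Z mult_ac intro!: sum.cong)
  then show ?thesis by simp
qed

lemma support_rank_leI:
  assumes "tsupp (T :: 'a \<times> 'b \<times> 'c \<Rightarrow> 'f::field) = \<Phi>" "rank_le r T"
  shows "support_rank TYPE('f) \<Phi> \<le> r"
  unfolding support_rank_def using assms by (intro Least_le) blast

text \<open>The minimum is attained because the 0/1 indicator of a finite support is a sum of one
  product of three indicator forms per point.\<close>

lemma support_rank_witness:
  assumes "finite \<Phi>"
  obtains T :: "'a \<times> 'b \<times> 'c \<Rightarrow> 'f::field"
  where "tsupp T = \<Phi>" "rank_le (support_rank TYPE('f) \<Phi>) T"
proof -
  define T :: "'a \<times> 'b \<times> 'c \<Rightarrow> 'f" where "T = (\<lambda>x. of_bool (x \<in> \<Phi>))"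
  have "T (a, b, c) = (\<Sum>x\<in>\<Phi>. of_bool (a = fst x) * of_bool (b = fst (snd x))
      * of_bool (c = snd (snd x)))" for a b c
  proof -
    have "(\<Sum>x\<in>\<Phi>. of_bool (a = fst x) * of_bool (b = fst (snd x)) * of_bool (c = snd (snd x)))
        = (\<Sum>x\<in>\<Phi>. if x = (a, b, c) then 1 else (0 :: 'f))"
      by (intro sum.cong) auto
    then show ?thesis by (simp add: T_def sum.delta' assms)
  qed
  then have "rank_le (card \<Phi>) T"
    by (intro rank_leI_finite[where T = T and u = "\<lambda>x a. of_bool (a = fst x)"
          and v = "\<lambda>x b. of_bool (b = fst (snd x))" and w = "\<lambda>x c. of_bool (c = snd (snd x))"] assms)
  moreover have "tsupp T = \<Phi>" by (auto simp: tsupp_def T_def)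
  ultimately have "\<exists>r. \<exists>T :: 'a \<times> 'b \<times> 'c \<Rightarrow> 'f. tsupp T = \<Phi> \<and> rank_le r T" by blast
  from LeastI_ex[OF this] show ?thesis using that unfolding support_rank_def by blast
qed

lemma rank_le_pos:
  assumes "rank_le r T" "tsupp T \<noteq> {}"
  shows "r > 0"
  using assms by (cases r) (auto simp: rank_le_def tsupp_def)

lemma support_rank_pos:
  assumes "finite \<Phi>" "\<Phi> \<noteq> {}"
  shows "support_rank TYPE('f::field) \<Phi> \<ge> 1"
proof -
  obtain T :: "'a \<times> 'b \<times> 'c \<Rightarrow> 'f" where "tsupp T = \<Phi>" "rank_le (support_rank TYPE('f) \<Phi>) T"
    using support_rank_witness[OF assms(1)] .
  with rank_le_pos assms(2) show ?thesis by (metis Suc_leI One_nat_def)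
qed

section \<open>Products, substitutions and unions of supports\<close>

definition prod_supp ::
  "('a \<times> 'b \<times> 'c) set \<Rightarrow> ('d \<times> 'e \<times> 'g) set \<Rightarrow> (('a \<times> 'd) \<times> ('b \<times> 'e) \<times> ('c \<times> 'g)) set" where
  "prod_supp \<Phi> \<Psi> = {((a, d), (b, e), (c, g)) | a b c d e g. (a, b, c) \<in> \<Phi> \<and> (d, e, g) \<in> \<Psi>}"

lemma finite_prod_supp:
  assumes "finite \<Phi>" "finite \<Psi>"
  shows "finite (prod_supp \<Phi> \<Psi>)"
proof -
  have "prod_supp \<Phi> \<Psi> = (\<lambda>((a, b, c), (d, e, g)). ((a, d), (b, e), (c, g))) ` (\<Phi> \<times> \<Psi>)"
    by (force simp: prod_supp_def)
  then show ?thesis using assms by simp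
qed

lemma support_rank_prod_supp:
  assumes "finite \<Phi>" "finite \<Psi>"
  shows "support_rank TYPE('f::field) (prod_supp \<Phi> \<Psi>)
      \<le> support_rank TYPE('f) \<Phi> * support_rank TYPE('f) \<Psi>"
proof -
  obtain S :: "'a \<times> 'b \<times> 'c \<Rightarrow> 'f" where S: "tsupp S = \<Phi>" "rank_le (support_rank TYPE('f) \<Phi>) S"
    using support_rank_witness[OF assms(1)] .
  obtain T :: "'d \<times> 'e \<times> 'g \<Rightarrow> 'f" where T: "tsupp T = \<Psi>" "rank_le (support_rank TYPE('f) \<Psi>) T"
    using support_rank_witness[OF assms(2)] .
  define Z :: "('a \<times> 'd) \<times> ('b \<times> 'e) \<times> ('c \<times> 'g) \<Rightarrow> 'f" where
    "Z = (\<lambda>(a, b, c). S (fst a, fst b, fst c) * T (snd a, snd b, snd c))"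
  have "rank_le (support_rank TYPE('f) \<Phi> * support_rank TYPE('f) \<Psi>) Z"
    by (rule rank_le_prod[OF S(2) T(2)]) (simp add: Z_def)
  moreover have "tsupp Z = prod_supp \<Phi> \<Psi>"
    unfolding S(1)[symmetric] T(1)[symmetric] prod_supp_def
    by (auto simp: tsupp_def Z_def)
  ultimately show ?thesis by (intro support_rank_leI)
qed

text \<open>Each coefficient of the pulled-back tensor is a single coefficient of the old one or 0,
  so nothing can cancel and the field is arbitrary. Both the substitution and the restriction to A,
  B, C act on each linear form separately.\<close>

lemma support_rank_pullback:
  fixes \<Psi> :: "('d \<times> 'e \<times> 'g) set"
  assumes "finite \<Psi>"
    and "\<Phi> = {(a, b, c). a \<in> A \<and> b \<in> B \<and> c \<in> C \<and> (f a, g b, h c) \<in> \<Psi>}"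
  shows "support_rank TYPE('f::field) \<Phi> \<le> support_rank TYPE('f) \<Psi>"
proof -
  obtain T :: "'d \<times> 'e \<times> 'g \<Rightarrow> 'f" where T: "tsupp T = \<Psi>" "rank_le (support_rank TYPE('f) \<Psi>) T"
    using support_rank_witness[OF assms(1)] .
  define Z where "Z = (\<lambda>(a, b, c).
      of_bool (a \<in> A) * of_bool (b \<in> B) * of_bool (c \<in> C) * T (f a, g b, h c))"
  obtain u v w where "\<And>a b c. T (a, b, c)
      = (\<Sum>l<support_rank TYPE('f) \<Psi>. u l a * v l b * w l c)"
    using T(2) unfolding rank_le_def by blast
  then have "rank_le (card {..<support_rank TYPE('f) \<Psi>}) Z"
    by (intro rank_leI_finite[where u = "\<lambda>l a. of_bool (a \<in> A) * u l (f a)"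
          and v = "\<lambda>l b. of_bool (b \<in> B) * v l (g b)"
          and w = "\<lambda>l c. of_bool (c \<in> C) * w l (h c)"])
      (auto simp: Z_def sum_distrib_left algebra_simps)
  moreover have "tsupp Z = \<Phi>"
    unfolding assms(2) T(1)[symmetric] by (auto simp: tsupp_def Z_def)
  ultimately show ?thesis using support_rank_leI by fastforce
qed

lemma support_rank_cycle:
  fixes \<Phi> :: "('a \<times> 'b \<times> 'c) set"
  assumes "finite \<Phi>"
  shows "support_rank TYPE('f::field) ((\<lambda>(a, b, c). (b, c, a)) ` \<Phi>) \<le> support_rank TYPE('f) \<Phi>"
proof -
  obtain T :: "'a \<times> 'b \<times> 'c \<Rightarrow> 'f" where T: "tsupp T = \<Phi>" "rank_le (support_rank TYPE('f) \<Phi>) T"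
    using support_rank_witness[OF assms(1)] .
  define Z where "Z = (\<lambda>(b, c, a). T (a, b, c))"
  obtain u v w where "\<And>a b c. T (a, b, c)
      = (\<Sum>l<support_rank TYPE('f) \<Phi>. u l a * v l b * w l c)"
    using T(2) unfolding rank_le_def by blast
  then have "rank_le (card {..<support_rank TYPE('f) \<Phi>}) Z"
    by (intro rank_leI_finite[where u = v and v = w and w = u])
      (auto simp: Z_def algebra_simps)
  moreover have "tsupp Z = (\<lambda>(a, b, c). (b, c, a)) ` \<Phi>"
    unfolding T(1)[symmetric] by (force simp: tsupp_def Z_def)
  ultimately show ?thesis using support_rank_leI by fastforce
qed

text \<open>In a combination S + t T each point of the second support rules out only one value of t,
  and an infinite field has others.\<close>

lemma support_rank_Un:
  fixes \<Phi> :: "('a \<times> 'b \<times> 'c) set"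
  assumes inf: "infinite (UNIV :: 'f::field set)" and fin: "finite \<Phi>" "finite \<Psi>"
  shows "support_rank TYPE('f) (\<Phi> \<union> \<Psi>) \<le> support_rank TYPE('f) \<Phi> + support_rank TYPE('f) \<Psi>"
proof -
  obtain S :: "'a \<times> 'b \<times> 'c \<Rightarrow> 'f" where S: "tsupp S = \<Phi>" "rank_le (support_rank TYPE('f) \<Phi>) S"
    using support_rank_witness[OF fin(1)] .
  obtain T :: "'a \<times> 'b \<times> 'c \<Rightarrow> 'f" where T: "tsupp T = \<Psi>" "rank_le (support_rank TYPE('f) \<Psi>) T"
    using support_rank_witness[OF fin(2)] .
  let ?r = "support_rank TYPE('f) \<Phi>" and ?s = "support_rank TYPE('f) \<Psi>"
  have "finite (insert 0 ((\<lambda>x. - S x / T x) ` \<Psi>))" using fin by simp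
  then obtain t where t: "t \<notin> insert 0 ((\<lambda>x. - S x / T x) ` \<Psi>)"
    using ex_new_if_finite[OF inf] by blast
  define Z where "Z = (\<lambda>x. S x + t * T x)"
  obtain u v w where u: "\<And>a b c. S (a, b, c) = (\<Sum>l<?r. u l a * v l b * w l c)"
    using S(2) unfolding rank_le_def by blast
  obtain u' v' w' where u': "\<And>a b c. T (a, b, c) = (\<Sum>l<?s. u' l a * v' l b * w' l c)"
    using T(2) unfolding rank_le_def by blast
  have "rank_le (card ({..<?r} <+> {..<?s})) Z"
    by (rule rank_leI_finite[where u = "case_sum u (\<lambda>l a. t * u' l a)" and v = "case_sum v v'"
          and w = "case_sum w w'"])
      (auto simp: Z_def u u' sum.Plus sum_distrib_left mult.assoc)
  moreover have "Z x \<noteq> 0 \<longleftrightarrow> x \<in> \<Phi> \<union> \<Psi>" for x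
  proof (cases "x \<in> \<Psi>")
    case True
    then have "T x \<noteq> 0" "t \<noteq> - S x / T x" using t T(1) by (auto simp: tsupp_def)
    then have "Z x \<noteq> 0" unfolding Z_def
      by (metis add.commute add_eq_0_iff nonzero_eq_divide_eq)
    then show ?thesis using True by simp
  next
    case False
    then show ?thesis using S(1) T(1) by (auto simp: Z_def tsupp_def)
  qed
  then have "tsupp Z = \<Phi> \<union> \<Psi>" by (auto simp: tsupp_def)
  ultimately show ?thesis using support_rank_leI by (fastforce simp: card_Plus)
qed

lemma support_rank_UN:
  assumes inf: "infinite (UNIV :: 'f::field set)" and "\<And>i. i < N \<Longrightarrow> finite (\<Phi> i)"
    and "\<And>i. i < N \<Longrightarrow> support_rank TYPE('f) (\<Phi> i) \<le> r"
  shows "support_rank TYPE('f) (\<Union>i<N. \<Phi> i) \<le> N * r"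
  using assms(2,3)
proof (induction N)
  case 0
  have "support_rank TYPE('f) ({} :: ('a \<times> 'b \<times> 'c) set) \<le> 0"
    by (rule support_rank_leI[of "\<lambda>_. 0"]) (auto simp: tsupp_def rank_le_def)
  then show ?case by simp
next
  case (Suc N)
  have "support_rank TYPE('f) (\<Union>i<Suc N. \<Phi> i) = support_rank TYPE('f) (\<Phi> N \<union> (\<Union>i<N. \<Phi> i))"
    by (simp add: lessThan_Suc)
  also have "\<dots> \<le> support_rank TYPE('f) (\<Phi> N) + support_rank TYPE('f) (\<Union>i<N. \<Phi> i)"
    using Suc.prems by (intro support_rank_Un inf) auto
  also have "\<dots> \<le> r + N * r"
    using Suc by (intro add_mono) auto
  finally show ?case by simp
qed

text \<open>Mixed radix digits. As exponents of one parameter t, such weights give every triple its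
  own monomial, which still factors into a power for each of the three variables.\<close>

lemma ex_injective_weight:
  assumes "finite A" "finite B" "finite C"
  obtains e1 :: "'a \<Rightarrow> nat" and e2 :: "'b \<Rightarrow> nat" and e3 :: "'c \<Rightarrow> nat"
  where "inj_on (\<lambda>(a, b, c). e1 a + e2 b + e3 c) (A \<times> B \<times> C)"
proof -
  obtain f :: "'a \<Rightarrow> nat" and m where f: "f ` A = {i. i < m}" "inj_on f A"
    using finite_imp_inj_to_nat_seg[OF assms(1)] by blast
  obtain g :: "'b \<Rightarrow> nat" and n where g: "g ` B = {i. i < n}" "inj_on g B"
    using finite_imp_inj_to_nat_seg[OF assms(2)] by blast
  obtain h :: "'c \<Rightarrow> nat" where h: "inj_on h C"
    using finite_imp_inj_to_nat_seg[OF assms(3)] by blast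
  have "a = a' \<and> b = b' \<and> c = c'"
    if *: "a \<in> A" "a' \<in> A" "b \<in> B" "b' \<in> B" "c \<in> C" "c' \<in> C"
      "f a + m * g b + m * n * h c = f a' + m * g b' + m * n * h c'" for a a' b b' c c'
  proof -
    have lt: "f a < m" "f a' < m" "g b < n" "g b' < n" using * f g by auto
    have eq: "f a + m * (g b + n * h c) = f a' + m * (g b' + n * h c')"
      using * by (simp add: algebra_simps)
    then have 1: "f a = f a'"
      using lt by (metis mod_less mod_mult_self2)
    with eq lt have eq2: "g b + n * h c = g b' + n * h c'" by simp
    then have 2: "g b = g b'"
      using lt by (metis mod_less mod_mult_self2)
    with eq2 lt have "h c = h c'" by simp
    with 1 2 * f g h show ?thesis by (simp add: inj_on_eq_iff)
  qed
  then show ?thesis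
    by (intro that[of f "\<lambda>b. m * g b" "\<lambda>c. m * n * h c"]) (auto simp: inj_on_def)
qed

text \<open>Scaling the variables by generic powers of one parameter prevents any cancellation between
  the terms that are identified by the substitution.\<close>

lemma support_rank_image:
  fixes \<Phi> :: "('a \<times> 'b \<times> 'c) set" and f :: "'a \<Rightarrow> 'd" and g :: "'b \<Rightarrow> 'e" and h :: "'c \<Rightarrow> 'g"
  assumes inf: "infinite (UNIV :: 'f::field set)" and fin: "finite \<Phi>"
  shows "support_rank TYPE('f) ((\<lambda>(a, b, c). (f a, g b, h c)) ` \<Phi>) \<le> support_rank TYPE('f) \<Phi>"
proof -
  let ?r = "support_rank TYPE('f) \<Phi>" and ?F = "\<lambda>(a, b, c). (f a, g b, h c)"
  obtain T :: "'a \<times> 'b \<times> 'c \<Rightarrow> 'f" where T: "tsupp T = \<Phi>" "rank_le ?r T"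
    using support_rank_witness[OF fin] .
  obtain u v w where u: "\<And>a b c. T (a, b, c) = (\<Sum>l<?r. u l a * v l b * w l c)"
    using T(2) unfolding rank_le_def by blast
  define A B C where "A = fst ` \<Phi>" and "B = (fst \<circ> snd) ` \<Phi>" and "C = (snd \<circ> snd) ` \<Phi>"
  have finABC: "finite A" "finite B" "finite C" using fin by (auto simp: A_def B_def C_def)
  have sub: "\<Phi> \<subseteq> A \<times> B \<times> C" by (force simp: A_def B_def C_def)
  obtain e1 :: "'a \<Rightarrow> nat" and e2 :: "'b \<Rightarrow> nat" and e3 :: "'c \<Rightarrow> nat"
    where inj: "inj_on (\<lambda>(a, b, c). e1 a + e2 b + e3 c) (A \<times> B \<times> C)"
    using ex_injective_weight[OF finABC] .
  define e where "e = (\<lambda>(a, b, c). e1 a + e2 b + e3 c)"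
  have inj': "inj_on e (A \<times> B \<times> C)" using inj by (simp add: e_def)
  \<comment> \<open>The fibre is taken in the box and not in \<Phi>: for each y it is a product set,
    so the sum over it factors into three linear forms. The extra points carry coefficient
    0.\<close>
  define fib where "fib y = {x \<in> A \<times> B \<times> C. ?F x = y}" for y
  have fin_fib: "finite (fib y)" for y unfolding fib_def using finABC by simp
  \<comment> \<open>All coefficients identified with y, as a polynomial in the scaling parameter.
    The exponents in a fibre are distinct, so nothing merges and the polynomial is nonzero exactly
    when the fibre meets \<Phi>.\<close>
  define p where "p y = (\<Sum>x\<in>fib y. Polynomial.monom (T x) (e x))" for y
  have coeff_p: "Polynomial.coeff (p y) (e x) = T x" if "x \<in> fib y" for x y
  proof -
    have "Polynomial.coeff (p y) (e x) = (\<Sum>x'\<in>fib y. if e x' = e x then T x' else 0)"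
      by (simp add: p_def coeff_sum)
    also have "\<dots> = (\<Sum>x'\<in>fib y. if x' = x then T x' else 0)"
      using that inj' by (intro sum.cong) (auto simp: fib_def inj_on_eq_iff)
    finally show ?thesis using that fin_fib by simp
  qed
  have p_nz: "p y \<noteq> 0" if y: "y \<in> ?F ` \<Phi>" for y
  proof -
    obtain x where "x \<in> \<Phi>" "?F x = y" using y by blast
    with coeff_p[of x y] sub T(1) show ?thesis by (auto simp: fib_def tsupp_def)
  qed
  have p_z: "p y = 0" if y: "y \<notin> ?F ` \<Phi>" for y
    unfolding p_def
  proof (intro sum.neutral ballI)
    fix x assume "x \<in> fib y"
    then have "x \<notin> \<Phi>" using y unfolding fib_def by blast
    then show "Polynomial.monom (T x) (e x) = 0" using T(1) by (auto simp: tsupp_def)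
  qed
  have "finite (\<Union>y\<in>?F ` \<Phi>. {t. poly (p y) t = 0})"
    using fin p_nz by (intro finite_UN_I) (auto simp: poly_roots_finite)
  then obtain t where t: "t \<notin> (\<Union>y\<in>?F ` \<Phi>. {t. poly (p y) t = 0})"
    using ex_new_if_finite[OF inf] by blast
  define Z where "Z y = poly (p y) t" for y
  have "tsupp Z = ?F ` \<Phi>"
  proof -
    have "Z y \<noteq> 0 \<longleftrightarrow> y \<in> ?F ` \<Phi>" for y
    proof (cases "y \<in> ?F ` \<Phi>")
      case True
      then show ?thesis using t unfolding Z_def by blast
    next
      case False
      then show ?thesis using p_z[of y] by (simp only: Z_def) simp
    qed
    then show ?thesis unfolding tsupp_def by blast
  qed
  moreover have "Z (a', b', c') = (\<Sum>l<?r. (\<Sum>a\<in>{a\<in>A. f a = a'}. u l a * t ^ e1 a)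
      * (\<Sum>b\<in>{b\<in>B. g b = b'}. v l b * t ^ e2 b) * (\<Sum>c\<in>{c\<in>C. h c = c'}. w l c * t ^ e3 c))"
    for a' b' c'
  proof -
    let ?A = "{a\<in>A. f a = a'}" and ?B = "{b\<in>B. g b = b'}" and ?C = "{c\<in>C. h c = c'}"
    have "fib (a', b', c') = ?A \<times> ?B \<times> ?C" by (auto simp: fib_def)
    then have "Z (a', b', c') = (\<Sum>(a, b, c)\<in>?A \<times> ?B \<times> ?C. T (a, b, c) * t ^ (e1 a + e2 b + e3 c))"
      by (simp add: Z_def p_def poly_sum poly_monom e_def case_prod_unfold)
    also have "\<dots> = (\<Sum>(a, b, c)\<in>?A \<times> ?B \<times> ?C. \<Sum>l<?r.
        (u l a * t ^ e1 a) * ((v l b * t ^ e2 b) * (w l c * t ^ e3 c)))"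
      by (intro sum.cong) (auto simp: u sum_distrib_left sum_distrib_right power_add algebra_simps
          intro!: sum.cong)
    also have "\<dots> = (\<Sum>l<?r. \<Sum>(a, b, c)\<in>?A \<times> ?B \<times> ?C.
        (u l a * t ^ e1 a) * ((v l b * t ^ e2 b) * (w l c * t ^ e3 c)))"
      by (simp add: case_prod_unfold sum.swap[of _ "{..<?r}"])
    also have "\<dots> = (\<Sum>l<?r. (\<Sum>a\<in>?A. u l a * t ^ e1 a)
      * ((\<Sum>b\<in>?B. v l b * t ^ e2 b) * (\<Sum>c\<in>?C. w l c * t ^ e3 c)))"
      unfolding sum_product by (simp add: sum.cartesian_product sum_distrib_left)
    finally show ?thesis by (simp add: mult.assoc)
  qed
  then have "rank_le (card {..<?r}) Z"
    by (intro rank_leI_finite[where u = "\<lambda>l a'. \<Sum>a\<in>{a\<in>A. f a = a'}. u l a * t ^ e1 a"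
          and v = "\<lambda>l b'. \<Sum>b\<in>{b\<in>B. g b = b'}. v l b * t ^ e2 b"
          and w = "\<lambda>l c'. \<Sum>c\<in>{c\<in>C. h c = c'}. w l c * t ^ e3 c"]) simp_all
  ultimately show ?thesis using support_rank_leI by fastforce
qed

subsection \<open>Tensor powers\<close>

definition tens_pow :: "nat \<Rightarrow> ('a \<times> 'b \<times> 'c \<Rightarrow> 'f::comm_semiring_1) \<Rightarrow> 'a list \<times> 'b list \<times> 'c list \<Rightarrow> 'f"
  where "tens_pow n T = (\<lambda>(as, bs, cs). if length as = n \<and> length bs = n \<and> length cs = n
    then \<Prod>t<n. T (as ! t, bs ! t, cs ! t) else 0)"

lemma tsupp_tens_pow:
  "tsupp (tens_pow n (T :: 'a \<times> 'b \<times> 'c \<Rightarrow> 'f::field)) = supp_pow n (tsupp T)"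
  by (auto simp: tsupp_def tens_pow_def supp_pow_def split: if_splits)

text \<open>Expanding the product of n sums yields one term for each choice function
  \<open>s\<close>, and that term is again a product of three forms.\<close>

lemma rank_le_tens_pow:
  assumes "rank_le r T"
  shows "rank_le (r ^ n) (tens_pow n T)"
proof -
  obtain u v w where u: "\<And>a b c. T (a, b, c) = (\<Sum>l<r. u l a * v l b * w l c)"
    using assms unfolding rank_le_def by blast
  let ?S = "{..<n} \<rightarrow>\<^sub>E {..<r}"
  have "tens_pow n T (as, bs, cs) = (\<Sum>s\<in>?S.
      (if length as = n then \<Prod>t<n. u (s t) (as ! t) else 0)
      * (if length bs = n then \<Prod>t<n. v (s t) (bs ! t) else 0)
      * (if length cs = n then \<Prod>t<n. w (s t) (cs ! t) else 0))" for as bs cs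
    by (auto simp: tens_pow_def u prod_sum_PiE prod.distrib)
  then have "rank_le (card ?S) (tens_pow n T)"
    by (intro rank_leI_finite[where u = "\<lambda>s as. if length as = n then \<Prod>t<n. u (s t) (as ! t) else 0"
          and v = "\<lambda>s bs. if length bs = n then \<Prod>t<n. v (s t) (bs ! t) else 0"
          and w = "\<lambda>s cs. if length cs = n then \<Prod>t<n. w (s t) (cs ! t) else 0"])
      (auto intro: finite_PiE)
  then show ?thesis by (simp add: card_PiE)
qed

lemma finite_supp_pow:
  assumes "finite \<Phi>"
  shows "finite (supp_pow n \<Phi>)"
proof -
  let ?L = "\<lambda>A. {xs. set xs \<subseteq> A \<and> length xs = n}"
  have "supp_pow n \<Phi> \<subseteq> ?L (fst ` \<Phi>) \<times> ?L ((fst \<circ> snd) ` \<Phi>) \<times> ?L ((snd \<circ> snd) ` \<Phi>)"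
  proof
    fix x assume "x \<in> supp_pow n \<Phi>"
    then obtain as bs cs where x: "x = (as, bs, cs)" "length as = n" "length bs = n" "length cs = n"
      "\<And>l. l < n \<Longrightarrow> (as ! l, bs ! l, cs ! l) \<in> \<Phi>" by (auto simp: supp_pow_def)
    have "as ! l \<in> fst ` \<Phi> \<and> bs ! l \<in> (fst \<circ> snd) ` \<Phi> \<and> cs ! l \<in> (snd \<circ> snd) ` \<Phi>" if "l < n" for l
      using x(5)[OF that] by force
    with x show "x \<in> ?L (fst ` \<Phi>) \<times> ?L ((fst \<circ> snd) ` \<Phi>) \<times> ?L ((snd \<circ> snd) ` \<Phi>)"
      by (auto simp: in_set_conv_nth)
  qed
  then show ?thesis
    using assms by (elim finite_subset) (intro finite_cartesian_product finite_lists_length_eq; simp)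
qed

lemma supp_pow_nonempty:
  assumes "\<Phi> \<noteq> {}"
  shows "supp_pow n \<Phi> \<noteq> {}"
proof -
  obtain a b c where "(a, b, c) \<in> \<Phi>" using assms by auto
  then have "(replicate n a, replicate n b, replicate n c) \<in> supp_pow n \<Phi>"
    by (auto simp: supp_pow_def)
  then show ?thesis by blast
qed

lemma asymp_support_rank_le:
  assumes "n \<ge> 1"
  shows "asymp_support_rank TYPE('f::field) \<Phi>
    \<le> real (support_rank TYPE('f) (supp_pow n \<Phi>)) powr (1 / real n)"
  unfolding asymp_support_rank_def using assms
  by (intro cINF_lower bdd_belowI[of _ 0]) auto

lemma asymp_support_rank_ge:
  assumes "\<And>n. n \<ge> 1 \<Longrightarrow> x \<le> real (support_rank TYPE('f::field) (supp_pow n \<Phi>)) powr (1 / real n)"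
  shows "x \<le> asymp_support_rank TYPE('f) \<Phi>"
  unfolding asymp_support_rank_def using assms by (intro cINF_greatest) auto

lemma asymp_support_rank_ge_1:
  assumes "finite \<Phi>" "\<Phi> \<noteq> {}"
  shows "asymp_support_rank TYPE('f::field) \<Phi> \<ge> 1"
proof (rule asymp_support_rank_ge)
  fix n :: nat assume "n \<ge> 1"
  have "support_rank TYPE('f) (supp_pow n \<Phi>) \<ge> 1"
    using assms by (intro support_rank_pos finite_supp_pow supp_pow_nonempty)
  then show "1 \<le> real (support_rank TYPE('f) (supp_pow n \<Phi>)) powr (1 / real n)"
    by (intro ge_one_powr_ge_zero) auto
qed

subsection \<open>Border rank\<close>

text \<open>Gaussian elimination, one coordinate of M at a time: either t is in the span of V on M,
  by means of \<open>card M\<close> vectors of V, or a linear functional vanishes on V but not at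
  t.\<close>

lemma span_or_functional:
  fixes V :: "('e \<Rightarrow> 'f::field) set"
  assumes "finite M" "V \<noteq> {}"
  shows "(\<exists>w \<mu>. (\<forall>i<card M. w i \<in> V) \<and> (\<forall>e\<in>M. t e = (\<Sum>i<card M. \<mu> i * w i e))) \<or>
    (\<exists>c. (\<forall>v\<in>V. (\<Sum>e\<in>M. c e * v e) = 0) \<and> (\<Sum>e\<in>M. c e * t e) \<noteq> 0)"
  using assms
proof (induction M arbitrary: V t rule: finite_induct)
  case empty
  then show ?case by simp
next
  case (insert e0 M)
  have card: "card (insert e0 M) = Suc (card M)" using insert.hyps by simp
  have upd: "(\<Sum>e\<in>M. (c(e0 := y)) e * v e) = (\<Sum>e\<in>M. c e * v e)" for c v and y :: 'f
    using insert.hyps by (intro sum.cong) auto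
  show ?case
  proof (cases "\<forall>v\<in>V. v e0 = 0")
    case all0: True
    show ?thesis
    proof (cases "t e0 = 0")
      case t0: True
      from insert.IH[OF insert.prems, of t] show ?thesis
      proof (elim disjE exE conjE)
        fix w \<mu>
        assume w: "\<forall>i<card M. w i \<in> V" "\<forall>e\<in>M. t e = (\<Sum>i<card M. \<mu> i * w i e)"
        \<comment> \<open>The statement asks for a fixed number of vectors, so an arbitrary one is
          appended with coefficient 0.\<close>
        obtain v0 where "v0 \<in> V" using insert.prems by blast
        moreover have "(\<Sum>i<Suc (card M). (\<mu>(card M := 0)) i * (w(card M := v0)) i e)
            = (\<Sum>i<card M. \<mu> i * w i e)" for e
          by simp
        moreover have "(\<Sum>i<card M. \<mu> i * w i e0) = 0"
          using w(1) all0 by (intro sum.neutral) auto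
        ultimately show ?thesis unfolding card using w t0
          by (intro disjI1 exI[of _ "w(card M := v0)"] exI[of _ "\<mu>(card M := 0)"])
            (auto simp: less_Suc_eq simp del: sum.lessThan_Suc)
      next
        fix c
        assume "\<forall>v\<in>V. (\<Sum>e\<in>M. c e * v e) = 0" "(\<Sum>e\<in>M. c e * t e) \<noteq> 0"
        then show ?thesis using insert.hyps upd[of c 0]
          by (intro disjI2 exI[of _ "c(e0 := 0)"]) simp
      qed
    next
      case False
      \<comment> \<open>Here the coordinate e0 itself separates t from V.\<close>
      have "(\<Sum>e\<in>M. of_bool (e = e0) * v e) = 0" for v :: "'e \<Rightarrow> 'f"
        using insert.hyps by (intro sum.neutral) auto
      then show ?thesis using False all0 insert.hyps
        by (intro disjI2 exI[of _ "\<lambda>e. of_bool (e = e0)"]) simp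
    qed
  next
    case False
    then obtain v0 where v0: "v0 \<in> V" "v0 e0 \<noteq> 0" by blast
    \<comment> \<open>Elimination of the coordinate e0 with pivot v0.\<close>
    define red where "red v = (\<lambda>e. v e - v e0 / v0 e0 * v0 e)" for v :: "'e \<Rightarrow> 'f"
    have "red ` V \<noteq> {}" using insert.prems by simp
    from insert.IH[OF this, of "red t"] show ?thesis
    proof (elim disjE exE conjE)
      fix w \<mu>
      assume w: "\<forall>i<card M. w i \<in> red ` V" "\<forall>e\<in>M. red t e = (\<Sum>i<card M. \<mu> i * w i e)"
      then have "\<forall>i. \<exists>v. i < card M \<longrightarrow> v \<in> V \<and> w i = red v" by blast
      from choice[OF this] obtain w' where
        w': "\<And>i. i < card M \<Longrightarrow> w' i \<in> V" "\<And>i. i < card M \<Longrightarrow> w i = red (w' i)"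
        by blast
      \<comment> \<open>The multiple of v0 that remains after the reductions of t and of the chosen
        vectors are undone.\<close>
      define y where "y = t e0 / v0 e0 - (\<Sum>i<card M. \<mu> i * (w' i e0 / v0 e0))"
      have "t e = (\<Sum>i<card M. \<mu> i * w' i e) + y * v0 e" if "e \<in> insert e0 M" for e
      proof -
        have "red t e = (\<Sum>i<card M. \<mu> i * red (w' i) e)"
        proof (cases "e = e0")
          case True
          then show ?thesis using v0 by (simp add: red_def)
        next
          case False
          then show ?thesis using that w w' by simp
        qed
        then have "t e = (\<Sum>i<card M. \<mu> i * red (w' i) e) + t e0 / v0 e0 * v0 e"
          by (simp add: red_def algebra_simps)
        also have "(\<Sum>i<card M. \<mu> i * red (w' i) e)
            = (\<Sum>i<card M. \<mu> i * w' i e) - (\<Sum>i<card M. \<mu> i * (w' i e0 / v0 e0)) * v0 e"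
          by (simp add: red_def sum_distrib_right right_diff_distrib sum_subtractf mult.assoc)
        finally show ?thesis by (simp add: y_def algebra_simps)
      qed
      then have eq: "\<forall>e\<in>insert e0 M. t e = (\<Sum>i<Suc (card M). (\<mu>(card M := y)) i * (w'(card M := v0)) i e)"
        by simp
      have "\<forall>i<Suc (card M). (w'(card M := v0)) i \<in> V"
        using w'(1) v0(1) by (simp add: less_Suc_eq)
      with eq show ?thesis unfolding card by blast
    next
      fix c
      assume c: "\<forall>v\<in>red ` V. (\<Sum>e\<in>M. c e * v e) = 0" "(\<Sum>e\<in>M. c e * red t e) \<noteq> 0"
      \<comment> \<open>The value at e0 for which the extended functional kills v0; it then depends
        on v only through \<open>red v\<close>.\<close>
      define y where "y = - (\<Sum>e\<in>M. c e * v0 e) / v0 e0"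
      have "(\<Sum>e\<in>insert e0 M. (c(e0 := y)) e * v e) = (\<Sum>e\<in>M. c e * red v e)" for v
      proof -
        have "(\<Sum>e\<in>insert e0 M. (c(e0 := y)) e * v e) = y * v e0 + (\<Sum>e\<in>M. c e * v e)"
          using insert.hyps upd[of c y v] by simp
        also have "(\<Sum>e\<in>M. c e * v e) = (\<Sum>e\<in>M. c e * red v e) + v e0 / v0 e0 * (\<Sum>e\<in>M. c e * v0 e)"
          by (simp add: red_def sum_distrib_left sum.distrib[symmetric] algebra_simps)
        finally show ?thesis by (simp add: y_def)
      qed
      with c show ?thesis by (intro disjI2 exI[of _ "c(e0 := y)"]) auto
    qed
  qed
qed

section \<open>Polynomial functions and tensors of bounded rank\<close>

lemma polyfun_sum:
  assumes "finite M" "\<And>i. i \<in> M \<Longrightarrow> p i \<in> polyfun D"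
  shows "(\<lambda>T. \<Sum>i\<in>M. p i T) \<in> polyfun D"
  using assms by (induction M rule: finite_induct) (auto intro: polyfun.intros)

lemma polyfun_prod:
  assumes "finite M" "\<And>i. i \<in> M \<Longrightarrow> p i \<in> polyfun D"
  shows "(\<lambda>T. \<Prod>i\<in>M. p i T) \<in> polyfun D"
  using assms by (induction M rule: finite_induct) (auto intro: polyfun.intros)

lemma polyfun_power:
  assumes "p \<in> polyfun D"
  shows "(\<lambda>T. p T ^ n) \<in> polyfun D"
  using assms by (induction n) (auto intro: polyfun.intros)

text \<open>Along a polynomial curve the question whether p vanishes concerns a polynomial in one
  variable, which has finitely many roots unless it is 0.\<close>

lemma polyfun_curve:
  fixes L :: "'k::comm_ring_1 \<Rightarrow> 'a \<times> 'b \<times> 'c \<Rightarrow> 'k"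
  assumes "p \<in> polyfun D" "\<And>x. \<exists>q. \<forall>t. L t x = poly q t"
  shows "\<exists>q. \<forall>t. p (L t) = poly q t"
  using assms(1)
proof induction
  case (const c)
  show ?case by (intro exI[of _ "[:c:]"]) simp
next
  case (coord x)
  show ?case by (rule assms(2))
next
  case (add p q)
  then show ?case by (metis poly_add)
next
  case (mult p q)
  then show ?case by (metis poly_mult)
qed

text \<open>The tensors of rank at most r on a box D are the image of an affine space under this
  polynomial map. The sum type collects all parameters in one function, so that they can be changed
  one by one.\<close>

definition param_tensor ::
  "('a \<times> 'b \<times> 'c) set \<Rightarrow> nat \<Rightarrow> (nat \<times> ('a + 'b + 'c) \<Rightarrow> 'k::comm_ring_1) \<Rightarrow> 'a \<times> 'b \<times> 'c \<Rightarrow> 'k" where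
  "param_tensor D r z = (\<lambda>(a, b, c). if (a, b, c) \<in> D
     then \<Sum>l<r. z (l, Inl a) * z (l, Inr (Inl b)) * z (l, Inr (Inr c)) else 0)"

lemma param_tensor_curve:
  "\<exists>q. \<forall>t. param_tensor D r (z(y := t)) x = poly q t"
proof -
  obtain a b c where x: "x = (a, b, c)" by (metis prod_cases3)
  define lin where "lin y' = (if y' = y then [:0, 1:] else [:z y':])" for y'
  have lin: "poly (lin y') t = (z(y := t)) y'" for y' t by (simp add: lin_def)
  show ?thesis
    by (intro exI[of _ "if x \<in> D then \<Sum>l<r. lin (l, Inl a) * lin (l, Inr (Inl b)) * lin (l, Inr (Inr c)) else 0"])
      (simp add: param_tensor_def x poly_sum lin del: fun_upd_apply)
qed

text \<open>Cutting off outside D costs no rank because D is a box: its indicator is a product of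
  three one-variable indicators, absorbed by the linear forms.\<close>

lemma rank_le_param_tensor:
  assumes "D = A \<times> B \<times> C"
  shows "rank_le r (param_tensor D r z)"
proof -
  have "rank_le (card {..<r}) (param_tensor D r z)"
    by (rule rank_leI_finite[where u = "\<lambda>l a. of_bool (a \<in> A) * z (l, Inl a)"
          and v = "\<lambda>l b. of_bool (b \<in> B) * z (l, Inr (Inl b))"
          and w = "\<lambda>l c. of_bool (c \<in> C) * z (l, Inr (Inr c))"])
      (auto simp: param_tensor_def assms)
  then show ?thesis by simp
qed

lemma rank_le_eq_param_tensor:
  assumes "rank_le r S" "\<And>x. x \<notin> D \<Longrightarrow> S x = 0"
  obtains z where "S = param_tensor D r z"
proof -
  obtain u v w where u: "\<And>a b c. S (a, b, c) = (\<Sum>l<r. u l a * v l b * w l c)"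
    using assms(1) unfolding rank_le_def by blast
  have "S = param_tensor D r (\<lambda>(l, y). case_sum (u l) (case_sum (v l) (w l)) y)"
    using assms(2) by (auto simp: param_tensor_def fun_eq_iff u[symmetric])
  then show ?thesis by (rule that)
qed

text \<open>A polynomial over the algebraic closure that does not vanish at some parameter keeps this
  property when the coordinates of the parameter are moved into the infinite base field one at a
  time.\<close>

lemma param_descent:
  fixes p :: "('a \<times> 'b \<times> 'c \<Rightarrow> 'f::field alg_closure) \<Rightarrow> 'f alg_closure"
  assumes inf: "infinite (UNIV :: 'f set)" and p: "p \<in> polyfun D" and "finite Y"
    and nz: "p (param_tensor D r z) \<noteq> 0"
  shows "\<exists>z'. p (param_tensor D r z') \<noteq> 0 \<and> z' ` Y \<subseteq> range to_ac"
  using assms(3)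
proof (induction Y rule: finite_induct)
  case empty
  then show ?case using nz by auto
next
  case (insert y Y)
  then obtain z' where z': "p (param_tensor D r z') \<noteq> 0" "z' ` Y \<subseteq> range to_ac" by blast
  obtain q where q: "\<And>t. p (param_tensor D r (z'(y := t))) = poly q t"
    using polyfun_curve[OF p, of "\<lambda>t. param_tensor D r (z'(y := t))"] param_tensor_curve by blast
  have "poly q (z' y) \<noteq> 0" using q[of "z' y"] z' by simp
  then have "q \<noteq> 0" by auto
  then have "finite {t. poly q t = 0}" by (rule poly_roots_finite)
  moreover have "infinite (range (to_ac :: 'f \<Rightarrow> _))"
    using inf inj_to_ac finite_imageD by blast
  ultimately have "\<not> range to_ac \<subseteq> {t. poly q t = 0}"
    using finite_subset by blast
  then obtain t where t: "t \<in> range to_ac" "poly q t \<noteq> 0" by blast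
  have "(z'(y := t)) ` insert y Y \<subseteq> range to_ac" using t(1) z'(2) by auto
  with t(2) q[of t] show ?case
    by (intro exI[of _ "z'(y := t)"]) (simp del: fun_upd_apply)
qed

text \<open>Zariski density of the tensors with entries in the base field among those of rank at
  most r over its closure.\<close>

lemma polyfun_vanish_extend:
  fixes p :: "('a \<times> 'b \<times> 'c \<Rightarrow> 'f::field alg_closure) \<Rightarrow> 'f alg_closure"
  assumes inf: "infinite (UNIV :: 'f set)" and p: "p \<in> polyfun D"
    and D: "D = A \<times> B \<times> C" "finite A" "finite B" "finite C"
    and van: "\<And>s :: 'a \<times> 'b \<times> 'c \<Rightarrow> 'f. rank_le r s \<Longrightarrow> (\<And>x. x \<notin> D \<Longrightarrow> s x = 0) \<Longrightarrow> p (to_ac \<circ> s) = 0"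
    and S: "rank_le r S" "\<And>x. x \<notin> D \<Longrightarrow> S x = 0"
  shows "p S = 0"
proof (rule ccontr)
  assume nz: "p S \<noteq> 0"
  obtain z where z: "S = param_tensor D r z" using rank_le_eq_param_tensor[OF S] .
  \<comment> \<open>The parameters that influence the tensor. They are finitely many, so finitely
    many one-coordinate moves suffice; the values outside Y are irrelevant.\<close>
  define Y where "Y = {..<r} \<times> (Inl ` A \<union> Inr ` Inl ` B \<union> Inr ` Inr ` C)"
  have "finite Y" using D by (simp add: Y_def)
  from param_descent[OF inf p this nz[unfolded z]] obtain z' where
    z': "p (param_tensor D r z') \<noteq> 0" "z' ` Y \<subseteq> range to_ac" by blast
  define z0 where "z0 y = of_ac (z' y)" for y
  have z0: "to_ac (z0 y) = z' y" if "y \<in> Y" for y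
    using z'(2) that by (auto simp: z0_def intro!: to_ac_of_ac)
  have "to_ac \<circ> param_tensor D r z0 = param_tensor D r z'"
    by (auto simp: param_tensor_def fun_eq_iff to_ac_sum z0 D(1) Y_def intro!: sum.cong)
  moreover have "p (to_ac \<circ> param_tensor D r z0) = 0"
    by (rule van[OF rank_le_param_tensor[OF D(1)]]) (auto simp: param_tensor_def)
  ultimately show False using z' by simp
qed

text \<open>An entry of the n-th tensor power depends only on how often each index occurs, which is
  why the powers span a space of dimension polynomial in n.\<close>

lemma prod_eq_monomial:
  fixes S :: "'d \<Rightarrow> 'f::comm_ring_1" and n :: nat
  assumes "finite D" "\<And>t. t < n \<Longrightarrow> x t \<in> D"
  shows "(\<Prod>t<n. S (x t)) = (\<Prod>d\<in>D. S d ^ card {t. t < n \<and> x t = d})"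
proof -
  have "(\<Prod>t<n. S (x t)) = (\<Prod>d\<in>D. \<Prod>t\<in>{t\<in>{..<n}. x t = d}. S (x t))"
    using assms by (intro prod.group[symmetric]) auto
  also have "\<dots> = (\<Prod>d\<in>D. \<Prod>t\<in>{t. t < n \<and> x t = d}. S d)"
    by (intro prod.cong) auto
  finally show ?thesis by simp
qed

text \<open>Linear functionals on the span of the powers \<open>s\<^sup>\<otimes>\<^sup>n\<close> are homogeneous polynomials in \<open>s\<close>.\<close>

lemma rank_le_tens_pow_of_border:
  fixes T :: "'a \<times> 'b \<times> 'c \<Rightarrow> 'f::field"
  assumes inf: "infinite (UNIV :: 'f set)"
    and D: "D = A \<times> B \<times> C" "finite A" "finite B" "finite C"
    and border: "border_rank_le D r T"
  shows "rank_le ((n + 1) ^ card D * r ^ n) (tens_pow n T)"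
proof -
  have finD: "finite D" using D by simp
  \<comment> \<open>Exponent vectors with entries at most n. Not all of them have total degree n,
    but a polynomial bound on their number is enough.\<close>
  define M where "M = D \<rightarrow>\<^sub>E {..n}"
  have finM: "finite M" and cardM: "card M = (n + 1) ^ card D"
    using finD by (auto simp: M_def card_PiE intro: finite_PiE)
  define mon :: "('a \<times> 'b \<times> 'c \<Rightarrow> 'f) \<Rightarrow> ('a \<times> 'b \<times> 'c \<Rightarrow> nat) \<Rightarrow> 'f"
    where "mon S e = (\<Prod>d\<in>D. S d ^ e d)" for S e
  define R where "R = {s :: 'a \<times> 'b \<times> 'c \<Rightarrow> 'f. rank_le r s \<and> (\<forall>x. x \<notin> D \<longrightarrow> s x = 0)}"
  have T0: "T x = 0" if "x \<notin> D" for x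
  proof -
    have "(to_ac \<circ> T) x = 0"
      using border that unfolding border_rank_le_def zariski_closure_def by blast
    then show ?thesis by simp
  qed
  \<comment> \<open>The zero tensor has rank at most r for every r, so the duality lemma
    applies.\<close>
  have "(\<lambda>_. 0) \<in> R" by (auto simp: R_def rank_le_def intro!: exI[of _ "\<lambda>_ _. 0"])
  then have "mon ` R \<noteq> {}" by blast
  from span_or_functional[OF finM this, of "mon T"] show ?thesis
  proof (elim disjE exE conjE)
    fix w \<mu>
    assume w: "\<forall>i<card M. w i \<in> mon ` R" and T: "\<forall>e\<in>M. mon T e = (\<Sum>i<card M. \<mu> i * w i e)"
    from w have "\<forall>i. \<exists>s. i < card M \<longrightarrow> s \<in> R \<and> w i = mon s" by blast
    from choice[OF this] obtain s where
      s: "\<And>i. i < card M \<Longrightarrow> s i \<in> R" "\<And>i. i < card M \<Longrightarrow> w i = mon (s i)"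
      by blast
    have eq: "tens_pow n T (as, bs, cs) = (\<Sum>i<card M. \<mu> i * tens_pow n (s i) (as, bs, cs))" for as bs cs
    proof (cases "length as = n \<and> length bs = n \<and> length cs = n")
      case len: True
      let ?x = "\<lambda>t. (as ! t, bs ! t, cs ! t)"
      show ?thesis
      proof (cases "\<forall>t<n. ?x t \<in> D")
        case True
        define e where "e = restrict (\<lambda>d. card {t. t < n \<and> ?x t = d}) D"
        have "card {t. t < n \<and> ?x t = d} \<le> n" for d
          using card_mono[of "{..<n}" "{t. t < n \<and> ?x t = d}"] by auto
        then have e: "e \<in> M" by (auto simp: e_def M_def)
        have "tens_pow n S (as, bs, cs) = mon S e" for S :: "'a \<times> 'b \<times> 'c \<Rightarrow> 'f"
          using prod_eq_monomial[OF finD, of n ?x S] True len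
          by (simp add: tens_pow_def mon_def e_def)
        then show ?thesis using T e s by simp
      next
        case False
        then obtain t where t: "t < n" "?x t \<notin> D" by blast
        have "tens_pow n S (as, bs, cs) = 0" if "\<And>x. x \<notin> D \<Longrightarrow> S x = 0"
          for S :: "'a \<times> 'b \<times> 'c \<Rightarrow> 'f"
          using that[OF t(2)] t(1) len by (auto simp: tens_pow_def intro!: prod_zero)
        then have "tens_pow n T (as, bs, cs) = 0" "\<And>i. i < card M \<Longrightarrow> tens_pow n (s i) (as, bs, cs) = 0"
          using T0 s(1) unfolding R_def by blast+
        then show ?thesis by simp
      qed
    qed (auto simp: tens_pow_def)
    have "rank_le (card M * r ^ n) (tens_pow n T)"
      by (rule rank_le_lincomb[where S = "\<lambda>i. tens_pow n (s i)" and \<mu> = \<mu>])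
        (use s(1) eq in \<open>auto simp: R_def intro: rank_le_tens_pow\<close>)
    then show ?thesis by (simp add: cardM)
  next
    fix c
    assume c: "\<forall>v\<in>mon ` R. (\<Sum>e\<in>M. c e * v e) = 0" "(\<Sum>e\<in>M. c e * mon T e) \<noteq> 0"
    \<comment> \<open>A separating functional, read as a polynomial in the tensor entries. It
      vanishes on R, hence by density on all tensors of rank at most r over the closure, hence at T:
      a contradiction.\<close>
    define p :: "('a \<times> 'b \<times> 'c \<Rightarrow> 'f alg_closure) \<Rightarrow> 'f alg_closure"
      where "p = (\<lambda>S. \<Sum>e\<in>M. to_ac (c e) * (\<Prod>d\<in>D. S d ^ e d))"
    have p: "p \<in> polyfun D" unfolding p_def using finM finD
      by (intro polyfun_sum polyfun.mult polyfun.const polyfun_prod polyfun_power polyfun.coord)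
    have p_ac: "p (to_ac \<circ> s) = to_ac (\<Sum>e\<in>M. c e * mon s e)" for s
      by (simp add: p_def mon_def to_ac_sum to_ac_prod)
    have "p S = 0" if "rank_le r S" "\<And>x. x \<notin> D \<Longrightarrow> S x = 0" for S
      by (rule polyfun_vanish_extend[OF inf p D _ that]) (use c(1) in \<open>auto simp: p_ac R_def\<close>)
    then have "p (to_ac \<circ> T) = 0"
      using border p by (auto simp: border_rank_le_def zariski_closure_def)
    then show ?thesis using c(2) by (simp add: p_ac)
  qed
qed

section \<open>Border support rank\<close>

lemma border_rank_le_of_rank_le:
  assumes "rank_le r T" "tsupp T = \<Phi>"
  shows "border_rank_le (supp_dom \<Phi>) r T"
proof -
  have "rank_le r (to_ac \<circ> T)"
  proof -
    obtain u v w where "\<And>a b c. T (a, b, c) = (\<Sum>l<r. u l a * v l b * w l c)"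
      using assms unfolding rank_le_def by blast
    then show ?thesis unfolding rank_le_def
      by (intro exI[of _ "\<lambda>l a. to_ac (u l a)"] exI[of _ "\<lambda>l a. to_ac (v l a)"]
          exI[of _ "\<lambda>l a. to_ac (w l a)"]) (simp add: to_ac_sum)
  qed
  moreover have "T x = 0" if "x \<notin> supp_dom \<Phi>" for x
  proof -
    have "\<Phi> \<subseteq> supp_dom \<Phi>" by (force simp: supp_dom_def)
    then show ?thesis using assms(2) that by (auto simp: tsupp_def)
  qed
  ultimately show ?thesis by (auto simp: border_rank_le_def zariski_closure_def)
qed

lemma border_support_rank_le:
  assumes "finite \<Phi>"
  shows "border_support_rank TYPE('f::field) \<Phi> \<le> support_rank TYPE('f) \<Phi>"
proof -
  obtain T :: "'a \<times> 'b \<times> 'c \<Rightarrow> 'f" where T: "tsupp T = \<Phi>" "rank_le (support_rank TYPE('f) \<Phi>) T"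
    using support_rank_witness[OF assms] .
  with border_rank_le_of_rank_le[OF T(2,1)] show ?thesis
    unfolding border_support_rank_def
    by (intro Least_le[of "\<lambda>r. \<exists>T :: 'a \<times> 'b \<times> 'c \<Rightarrow> 'f. tsupp T = \<Phi> \<and> border_rank_le (supp_dom \<Phi>) r T"]) blast
qed

lemma border_support_rank_witness:
  assumes "finite \<Phi>"
  obtains T :: "'a \<times> 'b \<times> 'c \<Rightarrow> 'f::field"
  where "tsupp T = \<Phi>" "border_rank_le (supp_dom \<Phi>) (border_support_rank TYPE('f) \<Phi>) T"
proof -
  obtain T :: "'a \<times> 'b \<times> 'c \<Rightarrow> 'f" where T: "tsupp T = \<Phi>" "rank_le (support_rank TYPE('f) \<Phi>) T"
    using support_rank_witness[OF assms] .
  with border_rank_le_of_rank_le[OF T(2,1)]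
  have "\<exists>r. \<exists>T :: 'a \<times> 'b \<times> 'c \<Rightarrow> 'f. tsupp T = \<Phi> \<and> border_rank_le (supp_dom \<Phi>) r T" by blast
  from LeastI_ex[OF this] show ?thesis using that unfolding border_support_rank_def by blast
qed

text \<open>After the n-th root the polynomial factor becomes (n + 1)^(d/n), which tends to 1. The
  asymptotic rank is an infimum, so it lies below every term and thus below the limit.\<close>

lemma asymp_support_rank_le_border:
  fixes \<Phi> :: "('a \<times> 'b \<times> 'c) set"
  assumes inf: "infinite (UNIV :: 'f::field set)" and fin: "finite \<Phi>"
  shows "asymp_support_rank TYPE('f) \<Phi> \<le> real (border_support_rank TYPE('f) \<Phi>)"
proof -
  let ?r = "border_support_rank TYPE('f) \<Phi>" and ?d = "card (supp_dom \<Phi>)"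
  obtain T :: "'a \<times> 'b \<times> 'c \<Rightarrow> 'f" where T: "tsupp T = \<Phi>" "border_rank_le (supp_dom \<Phi>) ?r T"
    using border_support_rank_witness[OF fin] .
  have le: "asymp_support_rank TYPE('f) \<Phi> \<le> (real n + 1) powr (real ?d / real n) * real ?r"
    if n: "n \<ge> 1" for n
  proof -
    have "rank_le ((n + 1) ^ ?d * ?r ^ n) (tens_pow n T)"
      by (rule rank_le_tens_pow_of_border[OF inf supp_dom_def _ _ _ T(2)]) (use fin in auto)
    then have "support_rank TYPE('f) (supp_pow n \<Phi>) \<le> (n + 1) ^ ?d * ?r ^ n"
      by (intro support_rank_leI[of "tens_pow n T"]) (simp_all add: tsupp_tens_pow T)
    then have "real (support_rank TYPE('f) (supp_pow n \<Phi>)) \<le> real ((n + 1) ^ ?d * ?r ^ n)"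
      by (simp only: of_nat_le_iff)
    then have "real (support_rank TYPE('f) (supp_pow n \<Phi>)) \<le> (real n + 1) ^ ?d * real ?r ^ n"
      by (simp add: add.commute)
    then have "real (support_rank TYPE('f) (supp_pow n \<Phi>)) powr (1 / real n)
        \<le> ((real n + 1) ^ ?d * real ?r ^ n) powr (1 / real n)"
      by (intro powr_mono2) auto
    also have "\<dots> = (real n + 1) powr (real ?d / real n) * real ?r"
      using n by (cases "?r = 0") (simp_all add: powr_mult powr_powr flip: powr_realpow)
    finally show ?thesis using asymp_support_rank_le[OF n, where 'f = 'f and \<Phi> = \<Phi>] by linarith
  qed
  have "(\<lambda>n. (real n + 1) powr (real ?d / real n) * real ?r) \<longlonglongrightarrow> 1 * real ?r"
    by (intro tendsto_mult tendsto_const) real_asymp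
  then have "(\<lambda>n. (real n + 1) powr (real ?d / real n) * real ?r) \<longlonglongrightarrow> real ?r" by simp
  then show ?thesis
    by (rule LIMSEQ_le_const) (use le in blast)
qed

subsection \<open>Matrix multiplication supports\<close>

lemma mm_supp_eq_image: "mm_supp \<Lambda> = (\<lambda>(i, j, k). ((i, j), (j, k), (k, i))) ` \<Lambda>"
  by (force simp: mm_supp_def)

lemma finite_mm_supp: "finite \<Lambda> \<Longrightarrow> finite (mm_supp \<Lambda>)"
  by (simp add: mm_supp_eq_image)

lemma mem_mm_supp_box:
  "((i, j), (j', k), (k', i')) \<in> mm_supp (I \<times> J \<times> K)
    \<longleftrightarrow> i' = i \<and> j' = j \<and> k' = k \<and> i \<in> I \<and> j \<in> J \<and> k \<in> K"
  by (auto simp: mm_supp_def)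

text \<open>A pullback along injections. Injectivity makes the matching conditions between the three
  index pairs the same before and after, so only the cardinalities matter.\<close>

lemma support_rank_mm_card_mono:
  fixes I :: "'a set" and J :: "'b set" and K :: "'c set"
    and I' :: "'d set" and J' :: "'e set" and K' :: "'g set"
  assumes fin: "finite I" "finite J" "finite K" "finite I'" "finite J'" "finite K'"
    and card: "card I \<le> card I'" "card J \<le> card J'" "card K \<le> card K'"
  shows "support_rank TYPE('f::field) (mm_supp (I \<times> J \<times> K))
    \<le> support_rank TYPE('f) (mm_supp (I' \<times> J' \<times> K'))"
proof -
  obtain f where f: "f ` I \<subseteq> I'" "inj_on f I" using card_le_inj fin card by metis
  obtain g where g: "g ` J \<subseteq> J'" "inj_on g J" using card_le_inj fin card by metis
  obtain h where h: "h ` K \<subseteq> K'" "inj_on h K" using card_le_inj fin card by metis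
  show ?thesis
  proof (rule support_rank_pullback)
    show "finite (mm_supp (I' \<times> J' \<times> K'))" using fin by (intro finite_mm_supp) simp
    show "mm_supp (I \<times> J \<times> K) = {(x, y, z). x \<in> I \<times> J \<and> y \<in> J \<times> K \<and> z \<in> K \<times> I \<and>
      (map_prod f g x, map_prod g h y, map_prod h f z) \<in> mm_supp (I' \<times> J' \<times> K')}"
      using f g h by (auto simp: mem_mm_supp_box image_subset_iff inj_on_eq_iff)
  qed
qed

lemma support_rank_mm_prod:
  assumes fin: "finite I" "finite J" "finite K" "finite I'" "finite J'" "finite K'"
  shows "support_rank TYPE('f::field) (mm_supp ((I \<times> I') \<times> (J \<times> J') \<times> (K \<times> K')))
    \<le> support_rank TYPE('f) (mm_supp (I \<times> J \<times> K)) * support_rank TYPE('f) (mm_supp (I' \<times> J' \<times> K'))"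
proof -
  let ?s = "\<lambda>((i, i'), (j, j')). ((i, j), (i', j'))"
  have fin': "finite (mm_supp (I \<times> J \<times> K))" "finite (mm_supp (I' \<times> J' \<times> K'))"
    using fin by (auto intro!: finite_mm_supp)
  have "support_rank TYPE('f) (mm_supp ((I \<times> I') \<times> (J \<times> J') \<times> (K \<times> K')))
    \<le> support_rank TYPE('f) (prod_supp (mm_supp (I \<times> J \<times> K)) (mm_supp (I' \<times> J' \<times> K')))"
  proof (rule support_rank_pullback)
    show "finite (prod_supp (mm_supp (I \<times> J \<times> K)) (mm_supp (I' \<times> J' \<times> K')))"
      using fin' by (rule finite_prod_supp)
    show "mm_supp ((I \<times> I') \<times> (J \<times> J') \<times> (K \<times> K')) = {(x, y, z). x \<in> UNIV \<and> y \<in> UNIV \<and> z \<in> UNIV \<and>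
      (?s x, ?s y, ?s z) \<in> prod_supp (mm_supp (I \<times> J \<times> K)) (mm_supp (I' \<times> J' \<times> K'))}"
      by (auto simp: mem_mm_supp_box prod_supp_def)
  qed
  also have "\<dots> \<le> support_rank TYPE('f) (mm_supp (I \<times> J \<times> K))
      * support_rank TYPE('f) (mm_supp (I' \<times> J' \<times> K'))"
    using fin' by (rule support_rank_prod_supp)
  finally show ?thesis .
qed

lemma support_rank_mm_cycle:
  assumes "finite I" "finite J" "finite K"
  shows "support_rank TYPE('f::field) (mm_supp (J \<times> K \<times> I))
    \<le> support_rank TYPE('f) (mm_supp (I \<times> J \<times> K))"
proof -
  have "mm_supp (J \<times> K \<times> I) = (\<lambda>(x, y, z). (y, z, x)) ` mm_supp (I \<times> J \<times> K)"
    unfolding mm_supp_eq_image image_image by force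
  then show ?thesis using assms by (simp add: support_rank_cycle finite_mm_supp)
qed

text \<open>A power of a matrix multiplication support is again one, over index sets of lists: lists
  of pairs are unzipped into pairs of lists.\<close>

lemma support_rank_supp_pow_mm:
  assumes "finite I" "finite J" "finite K"
  shows "support_rank TYPE('f::field) (supp_pow n (mm_supp (I \<times> J \<times> K)))
    \<le> support_rank TYPE('f) (mm_supp ({xs. set xs \<subseteq> I \<and> length xs = n} \<times>
        {xs. set xs \<subseteq> J \<and> length xs = n} \<times> {xs. set xs \<subseteq> K \<and> length xs = n}))"
    (is "_ \<le> support_rank _ (mm_supp (?I \<times> ?J \<times> ?K))")
proof (rule support_rank_pullback)
  let ?L = "{xs. length xs = n}" and ?u = "\<lambda>xs. (map fst xs, map snd xs)"
  show "finite (mm_supp (?I \<times> ?J \<times> ?K))"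
    using assms by (intro finite_mm_supp finite_cartesian_product finite_lists_length_eq)
  show "supp_pow n (mm_supp (I \<times> J \<times> K)) = {(x, y, z). x \<in> ?L \<and> y \<in> ?L \<and> z \<in> ?L \<and>
      (?u x, ?u y, ?u z) \<in> mm_supp (?I \<times> ?J \<times> ?K)}"
  proof -
    have "(\<forall>l<n. (x ! l, y ! l, z ! l) \<in> mm_supp (I \<times> J \<times> K))
        \<longleftrightarrow> (?u x, ?u y, ?u z) \<in> mm_supp (?I \<times> ?J \<times> ?K)"
      if len: "length x = n" "length y = n" "length z = n" for x y z
    proof -
      have 1: "(x ! l, y ! l, z ! l) \<in> mm_supp (I \<times> J \<times> K) \<longleftrightarrow>
          snd (z ! l) = fst (x ! l) \<and> fst (y ! l) = snd (x ! l) \<and> fst (z ! l) = snd (y ! l) \<and>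
          fst (x ! l) \<in> I \<and> snd (x ! l) \<in> J \<and> snd (y ! l) \<in> K" for l
        using mem_mm_supp_box[of "fst (x ! l)" "snd (x ! l)" "fst (y ! l)" "snd (y ! l)"
            "fst (z ! l)" "snd (z ! l)" I J K] by simp
      have 2: "map snd z = map fst x \<longleftrightarrow> (\<forall>l<n. snd (z ! l) = fst (x ! l))"
        "map fst y = map snd x \<longleftrightarrow> (\<forall>l<n. fst (y ! l) = snd (x ! l))"
        "map fst z = map snd y \<longleftrightarrow> (\<forall>l<n. fst (z ! l) = snd (y ! l))"
        using len by (auto simp: list_eq_iff_nth_eq)
      have 3: "set (map f w) \<subseteq> A \<longleftrightarrow> (\<forall>l<n. f (w ! l) \<in> A)" if "length w = n"
        for w :: "'x list" and f :: "'x \<Rightarrow> 'y" and A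
        using that by (simp only: subset_eq all_set_conv_all_nth) auto
      show ?thesis
        unfolding 1 mem_mm_supp_box 2 mem_Collect_eq length_map 3[OF len(1)] 3[OF len(2)]
        using len by blast
    qed
    then show ?thesis by (auto simp: supp_pow_def)
  qed
qed

lemma support_rank_mm_box_mono:
  assumes "l \<le> l'" "m \<le> m'" "n \<le> n'"
  shows "support_rank TYPE('f::field) (mm_supp (mm_box l m n))
    \<le> support_rank TYPE('f) (mm_supp (mm_box l' m' n'))"
  unfolding mm_box_def using assms by (intro support_rank_mm_card_mono) auto

lemma support_rank_mm_box_mult:
  "support_rank TYPE('f::field) (mm_supp (mm_box (l * l') (m * m') (n * n')))
    \<le> support_rank TYPE('f) (mm_supp (mm_box l m n)) * support_rank TYPE('f) (mm_supp (mm_box l' m' n'))"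
proof -
  have "support_rank TYPE('f) (mm_supp (mm_box (l * l') (m * m') (n * n')))
    \<le> support_rank TYPE('f) (mm_supp (({1..l} \<times> {1..l'}) \<times> ({1..m} \<times> {1..m'}) \<times> ({1..n} \<times> {1..n'})))"
    unfolding mm_box_def by (intro support_rank_mm_card_mono) (auto simp: card_cartesian_product)
  also have "\<dots> \<le> support_rank TYPE('f) (mm_supp (mm_box l m n))
      * support_rank TYPE('f) (mm_supp (mm_box l' m' n'))"
    unfolding mm_box_def by (intro support_rank_mm_prod) auto
  finally show ?thesis .
qed

lemma support_rank_mm_box_pos:
  assumes "l \<ge> 1" "m \<ge> 1" "n \<ge> 1"
  shows "support_rank TYPE('f::field) (mm_supp (mm_box l m n)) \<ge> 1"
  by (rule support_rank_pos) (use assms in \<open>auto simp: mm_supp_eq_image mm_box_def\<close>)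

text \<open>The product of a box with its two cyclic rotations is a cube, and the rotations have no
  larger support rank.\<close>

lemma support_rank_mm_box_cube:
  "support_rank TYPE('f::field) (mm_supp (mm_box (l * m * n) (l * m * n) (l * m * n)))
    \<le> support_rank TYPE('f) (mm_supp (mm_box l m n)) ^ 3"
proof -
  let ?R = "\<lambda>l m n. support_rank TYPE('f) (mm_supp (mm_box l m n))"
  have cyc: "?R m n l \<le> ?R l m n" for l m n
    unfolding mm_box_def by (intro support_rank_mm_cycle) auto
  have "?R (l * m * n) (l * m * n) (l * m * n) = ?R (l * (m * n)) (m * (n * l)) (n * (l * m))"
    by (simp add: mult_ac)
  also have "\<dots> \<le> ?R l m n * (?R m n l * ?R n l m)"
    by (intro order.trans[OF support_rank_mm_box_mult] mult_left_mono support_rank_mm_box_mult) simp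
  also have "\<dots> \<le> ?R l m n * (?R l m n * ?R l m n)"
    by (intro mult_mono cyc order.trans[OF cyc cyc]) simp_all
  finally show ?thesis by (simp add: power3_eq_cube)
qed

lemma log_support_rank_mm_mult_le:
  assumes "l \<ge> 1" "m \<ge> 1" "n \<ge> 1" "l' \<ge> 1" "m' \<ge> 1" "n' \<ge> 1"
  shows "log 2 (real (support_rank TYPE('f::field) (mm_supp (mm_box (l * l') (m * m') (n * n')))))
    \<le> log 2 (real (support_rank TYPE('f) (mm_supp (mm_box l m n))))
      + log 2 (real (support_rank TYPE('f) (mm_supp (mm_box l' m' n'))))"
proof -
  let ?R = "\<lambda>l m n. support_rank TYPE('f) (mm_supp (mm_box l m n))"
  have pos: "?R l m n \<ge> 1" "?R l' m' n' \<ge> 1" "?R (l * l') (m * m') (n * n') \<ge> 1"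
    using assms by (auto intro!: support_rank_mm_box_pos[unfolded One_nat_def])
  have "log 2 (real (?R (l * l') (m * m') (n * n'))) \<le> log 2 (real (?R l m n * ?R l' m' n'))"
    using pos(3) by (intro log_mono of_nat_mono support_rank_mm_box_mult) auto
  also have "\<dots> = log 2 (real (?R l m n)) + log 2 (real (?R l' m' n'))"
    using pos by (simp add: log_mult)
  finally show ?thesis .
qed

subsection \<open>The exponents\<close>

text \<open>Fekete's lemma for g + C, which is exactly subadditive; the constant disappears after
  division by n. The error C is there to absorb the rounding of the box sides.\<close>

lemma fekete_nonneg:
  fixes g :: "nat \<Rightarrow> real"
  assumes sub: "\<And>m n. g (m + n) \<le> g m + g n + C" and nonneg: "\<And>n. g n \<ge> 0" and C: "C \<ge> 0"
  shows "convergent (\<lambda>n. g n / real n)"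
proof -
  define h where "h n = g n + C" for n
  have h_sub: "h (m + n) \<le> h m + h n" for m n using sub[of m n] by (simp add: h_def)
  have h_nn: "h n \<ge> 0" for n using nonneg[of n] C by (simp add: h_def)
  have h_mult: "h (q * m + s) \<le> real q * h m + h s" for q m s
  proof (induction q)
    case (Suc q)
    have "h (Suc q * m + s) = h (m + (q * m + s))" by (simp add: algebra_simps)
    also have "\<dots> \<le> h m + h (q * m + s)" by (rule h_sub)
    finally show ?case using Suc by (simp add: algebra_simps)
  qed simp
  define L where "L = (INF n\<in>{1..}. h n / real n)"
  have bdd: "bdd_below ((\<lambda>n. h n / real n) ` {1..})"
    by (intro bdd_belowI[of _ 0]) (auto simp: h_nn)
  have L_le: "L \<le> h n / real n" if "n \<ge> 1" for n
    unfolding L_def using that by (intro cINF_lower bdd) auto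
  have "(\<lambda>n. h n / real n) \<longlonglongrightarrow> L"
  proof (rule LIMSEQ_I)
    fix r :: real assume r: "r > 0"
    have "Inf ((\<lambda>n. h n / real n) ` {1..}) < L + r / 2" using r by (simp add: L_def)
    then obtain m where m: "m \<ge> 1" "h m / real m < L + r / 2"
      by (subst (asm) cINF_less_iff[OF _ bdd]) auto
    define B where "B = Max (h ` {..<m})"
    have B: "h s \<le> B" if "s < m" for s unfolding B_def using that by (intro Max_ge) auto
    obtain N :: nat where N: "real N > 2 * \<bar>B\<bar> / r" using reals_Archimedean2 by blast
    have "norm (h n / real n - L) < r" if n: "n \<ge> max N 1" for n
    proof -
      have "h n \<le> real (n div m) * h m + h (n mod m)" using h_mult[of "n div m" m "n mod m"] by simp
      also have "\<dots> \<le> real n / real m * h m + B"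
        using m(1) h_nn by (intro add_mono mult_right_mono B of_nat_div_le_of_nat) auto
      finally have "h n / real n \<le> (real n / real m * h m + B) / real n"
        using n by (simp add: divide_right_mono)
      also have "\<dots> = h m / real m + B / real n" using n by (simp add: field_simps)
      also have "B / real n < r / 2"
      proof -
        have "2 * \<bar>B\<bar> < r * real n"
          using N n r by (smt (verit) max.boundedE mult.commute of_nat_mono pos_divide_less_eq)
        then show ?thesis using n by (auto simp: field_simps abs_if split: if_splits)
      qed
      finally have "h n / real n < L + r" using m(2) by linarith
      then show ?thesis using L_le[of n] n r by (simp add: abs_if)
    qed
    then show "\<exists>no. \<forall>n\<ge>no. norm (h n / real n - L) < r" by blast
  qed
  moreover have "(\<lambda>n. C / real n) \<longlonglongrightarrow> 0" by real_asymp
  ultimately have "(\<lambda>n. h n / real n - C / real n) \<longlonglongrightarrow> L - 0" by (rule tendsto_diff)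
  then show ?thesis by (auto simp: h_def diff_divide_distrib[symmetric] convergent_def)
qed

section \<open>Rounded side lengths and the rectangular exponent\<close>

lemma floor_powr_bounds:
  fixes a :: real and n :: nat
  assumes "a \<ge> 0"
  defines "x \<equiv> nat \<lfloor>2 powr (a * real n)\<rfloor>"
  shows "x \<ge> 1" "real x \<le> 2 powr (a * real n)" "2 powr (a * real n) \<le> 2 * real x"
    "a * real n - 1 \<le> log 2 (real x)"
proof -
  have "2 powr (a * real n) \<ge> 1" using assms by (intro ge_one_powr_ge_zero) auto
  then have "real x = of_int \<lfloor>2 powr (a * real n)\<rfloor>" "\<lfloor>2 powr (a * real n)\<rfloor> \<ge> 1"
    by (auto simp: x_def)
  then show 1: "x \<ge> 1" and "real x \<le> 2 powr (a * real n)" and 2: "2 powr (a * real n) \<le> 2 * real x"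
    by linarith+
  have "a * real n = log 2 (2 powr (a * real n))" by simp
  also have "\<dots> \<le> log 2 (2 * real x)" using 1 2 by (subst log_le_cancel_iff) auto
  also have "\<dots> = 1 + log 2 (real x)" using 1 by (simp add: log_mult)
  finally show "a * real n - 1 \<le> log 2 (real x)" by simp
qed

text \<open>Rounding down a number that is at least 1 loses a factor of at most 2, here twice. The
  resulting 4 in each direction is paid for by one box of side 4, a constant error in the
  subadditivity.\<close>

lemma floor_powr_add_le:
  fixes a :: real
  assumes "a \<ge> 0"
  shows "nat \<lfloor>2 powr (a * real (m + n))\<rfloor>
    \<le> 4 * (nat \<lfloor>2 powr (a * real m)\<rfloor> * nat \<lfloor>2 powr (a * real n)\<rfloor>)"
proof -
  have "real (nat \<lfloor>2 powr (a * real (m + n))\<rfloor>) \<le> 2 powr (a * real m) * 2 powr (a * real n)"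
    using floor_powr_bounds(2)[OF assms, of "m + n"] by (simp add: powr_add algebra_simps)
  also have "\<dots> \<le> (2 * real (nat \<lfloor>2 powr (a * real m)\<rfloor>)) * (2 * real (nat \<lfloor>2 powr (a * real n)\<rfloor>))"
    using floor_powr_bounds(3)[OF assms] by (intro mult_mono) auto
  finally have "real (nat \<lfloor>2 powr (a * real (m + n))\<rfloor>)
      \<le> real (4 * (nat \<lfloor>2 powr (a * real m)\<rfloor> * nat \<lfloor>2 powr (a * real n)\<rfloor>))" by simp
  then show ?thesis by (simp only: of_nat_le_iff)
qed

text \<open>The value of \<open>lim\<close> says nothing about a divergent sequence, so every
  statement on \<open>omega_s_abc\<close> rests on this convergence.\<close>

lemma omega_s_abc_LIMSEQ:
  assumes "a \<ge> 0" "b \<ge> 0" "c \<ge> 0"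
  shows "(\<lambda>n. log 2 (real (support_rank TYPE('f::field) (mm_supp
      (mm_box (nat \<lfloor>2 powr (a * real n)\<rfloor>) (nat \<lfloor>2 powr (b * real n)\<rfloor>) (nat \<lfloor>2 powr (c * real n)\<rfloor>)))))
      / real n) \<longlonglongrightarrow> omega_s_abc TYPE('f) a b c"
proof -
  let ?R = "\<lambda>l m n. support_rank TYPE('f) (mm_supp (mm_box l m n))"
  define x where "x a n = nat \<lfloor>2 powr (a * real n)\<rfloor>" for a :: real and n :: nat
  define g where "g n = log 2 (real (?R (x a n) (x b n) (x c n)))" for n
  have x1: "x a n \<ge> 1" "x b n \<ge> 1" "x c n \<ge> 1" for n
    unfolding x_def using assms by (auto intro!: floor_powr_bounds(1)[unfolded One_nat_def])
  have R1: "?R (x a n) (x b n) (x c n) \<ge> 1" for n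
    by (intro support_rank_mm_box_pos x1)
  have xx1: "x a m * x a n \<ge> 1" "x b m * x b n \<ge> 1" "x c m * x c n \<ge> 1" for m n
    using x1 by (simp_all add: Suc_le_eq)
  have "convergent (\<lambda>n. g n / real n)"
  proof (rule fekete_nonneg)
    show "g n \<ge> 0" for n using R1[of n] by (simp add: g_def)
    show "log 2 (real (?R 4 4 4)) \<ge> 0"
      using support_rank_mm_box_pos[of 4 4 4, where 'f = 'f] by simp
    show "g (m + n) \<le> g m + g n + log 2 (real (?R 4 4 4))" for m n
    proof -
      have "g (m + n) \<le> log 2 (real (?R (4 * (x a m * x a n)) (4 * (x b m * x b n)) (4 * (x c m * x c n))))"
        unfolding g_def x_def using R1[of "m + n", unfolded x_def] assms
        by (intro log_mono of_nat_mono support_rank_mm_box_mono floor_powr_add_le) auto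
      also have "\<dots> \<le> log 2 (real (?R 4 4 4))
          + log 2 (real (?R (x a m * x a n) (x b m * x b n) (x c m * x c n)))"
        by (intro log_support_rank_mm_mult_le xx1) simp_all
      also have "log 2 (real (?R (x a m * x a n) (x b m * x b n) (x c m * x c n))) \<le> g m + g n"
        unfolding g_def by (intro log_support_rank_mm_mult_le x1)
      finally show ?thesis by simp
    qed
  qed
  then show ?thesis
    unfolding g_def x_def omega_s_abc_def by (simp only: convergent_LIMSEQ_iff)
qed

section \<open>Comparing the square and the rectangular exponent\<close>

lemma omega_s_nonneg: "omega_s TYPE('f::field) \<ge> 0"
proof -
  have "asymp_support_rank TYPE('f) (mm_supp (mm_box 2 2 2)) \<ge> 1"
    by (rule asymp_support_rank_ge_1) (auto simp: mm_supp_eq_image mm_box_def)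
  then show ?thesis by (simp add: omega_s_def)
qed

lemma omega_s_mult_le_log_power:
  "omega_s TYPE('f::field) * real q \<le> log 2 (real (support_rank TYPE('f) (mm_supp (mm_box (2 ^ q) (2 ^ q) (2 ^ q)))))"
proof (cases "q = 0")
  case True
  then show ?thesis using support_rank_mm_box_pos[of 1 1 1, where 'f = 'f] by simp
next
  case False
  let ?\<Phi> = "mm_supp (mm_box 2 2 2)"
  let ?R = "support_rank TYPE('f) (supp_pow q ?\<Phi>)"
  have \<Phi>: "finite ?\<Phi>" "?\<Phi> \<noteq> {}" by (auto simp: mm_supp_eq_image mm_box_def)
  have R1: "?R \<ge> 1" by (intro support_rank_pos finite_supp_pow supp_pow_nonempty \<Phi>)
  have "asymp_support_rank TYPE('f) ?\<Phi> \<le> real ?R powr (1 / real q)"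
    using False by (intro asymp_support_rank_le) simp
  then have "omega_s TYPE('f) \<le> log 2 (real ?R powr (1 / real q))"
    unfolding omega_s_def using asymp_support_rank_ge_1[OF \<Phi>, where 'f = 'f]
    by (intro log_mono) auto
  also have "\<dots> = log 2 (real ?R) / real q" using R1 by (simp add: log_powr)
  finally have "omega_s TYPE('f) * real q \<le> log 2 (real ?R)" using False by (simp add: field_simps)
  also have "?R \<le> support_rank TYPE('f) (mm_supp (mm_box (2 ^ q) (2 ^ q) (2 ^ q)))"
    unfolding mm_box_def
    by (intro order.trans[OF support_rank_supp_pow_mm] support_rank_mm_card_mono)
      (auto simp: card_lists_length_eq finite_lists_length_eq)
  then have "log 2 (real ?R) \<le> log 2 (real (support_rank TYPE('f) (mm_supp (mm_box (2 ^ q) (2 ^ q) (2 ^ q)))))"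
    using R1 by (intro log_mono) auto
  finally show ?thesis .
qed

text \<open>Symmetrisation compares the box with a cube of side l m n. The summand -1 is the loss
  from rounding that side down to a power of 2.\<close>

lemma omega_s_log_le_support_rank_mm:
  assumes "l \<ge> 1" "m \<ge> 1" "n \<ge> 1"
  shows "omega_s TYPE('f::field) * (log 2 (real l) + log 2 (real m) + log 2 (real n) - 1)
    \<le> 3 * log 2 (real (support_rank TYPE('f) (mm_supp (mm_box l m n))))"
proof -
  let ?R = "\<lambda>l m n. support_rank TYPE('f) (mm_supp (mm_box l m n))"
  let ?L = "l * m * n"
  have L1: "?L \<ge> 1" using assms by (simp add: Suc_le_eq)
  define q where "q = nat \<lfloor>log 2 (real ?L)\<rfloor>"
  have q: "real q \<le> log 2 (real ?L)" "log 2 (real ?L) \<le> real q + 1"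
    using L1 by (auto simp: q_def simp del: of_nat_mult)
  have "(2 :: real) ^ q \<le> real ?L"
    using q(1) L1 by (metis le_log_iff less_le_trans of_nat_0_less_iff one_less_numeral_iff
        powr_realpow semiring_norm(76) zero_less_numeral zero_less_one)
  then have "real (2 ^ q) \<le> real ?L" by simp
  then have qL: "2 ^ q \<le> ?L" by (simp only: of_nat_le_iff)
  have "log 2 (real l) + log 2 (real m) + log 2 (real n) = log 2 (real ?L)"
    using assms by (simp add: log_mult)
  then have "omega_s TYPE('f) * (log 2 (real l) + log 2 (real m) + log 2 (real n) - 1)
      \<le> omega_s TYPE('f) * real q"
    using q(2) by (intro mult_left_mono omega_s_nonneg) simp
  also have "\<dots> \<le> log 2 (real (?R (2 ^ q) (2 ^ q) (2 ^ q)))"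
    by (rule omega_s_mult_le_log_power)
  also have "?R (2 ^ q) (2 ^ q) (2 ^ q) \<le> ?R l m n ^ 3"
    by (intro order.trans[OF support_rank_mm_box_mono[OF qL qL qL]] support_rank_mm_box_cube)
  then have "log 2 (real (?R (2 ^ q) (2 ^ q) (2 ^ q))) \<le> log 2 (real (?R l m n ^ 3))"
    using support_rank_mm_box_pos[of "2 ^ q" "2 ^ q" "2 ^ q", where 'f = 'f]
    by (intro log_mono of_nat_mono) auto
  also have "\<dots> = 3 * log 2 (real (?R l m n))"
    using support_rank_mm_box_pos[OF assms, where 'f = 'f] by (simp add: log_nat_power)
  finally show ?thesis .
qed

lemma omega_s_le_omega_s_abc:
  assumes "a \<ge> 0" "b \<ge> 0" "c \<ge> 0"
  shows "omega_s TYPE('f::field) * (a + b + c) \<le> 3 * omega_s_abc TYPE('f) a b c"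
proof (rule LIMSEQ_le)
  let ?\<omega> = "omega_s TYPE('f)"
  let ?g = "\<lambda>n. log 2 (real (support_rank TYPE('f) (mm_supp
      (mm_box (nat \<lfloor>2 powr (a * real n)\<rfloor>) (nat \<lfloor>2 powr (b * real n)\<rfloor>) (nat \<lfloor>2 powr (c * real n)\<rfloor>)))))"
  show "(\<lambda>n. 3 * (?g n / real n)) \<longlonglongrightarrow> 3 * omega_s_abc TYPE('f) a b c"
    by (intro tendsto_mult tendsto_const omega_s_abc_LIMSEQ assms)
  \<comment> \<open>The 4 collects a loss of 1 for each of the three rounded sides and the 1 from
    rounding the side of the cube.\<close>
  show "(\<lambda>n. ?\<omega> * (a + b + c - 4 / real n)) \<longlonglongrightarrow> ?\<omega> * (a + b + c)"
    by real_asymp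
  show "\<exists>N. \<forall>n\<ge>N. ?\<omega> * (a + b + c - 4 / real n) \<le> 3 * (?g n / real n)"
  proof (intro exI allI impI)
    fix n :: nat assume n: "n \<ge> 1"
    have "?\<omega> * (a + b + c - 4 / real n) * real n = ?\<omega> * ((a * real n - 1) + (b * real n - 1) + (c * real n - 1) - 1)"
      using n by (simp add: field_simps)
    also have "\<dots> \<le> ?\<omega> * (log 2 (real (nat \<lfloor>2 powr (a * real n)\<rfloor>))
        + log 2 (real (nat \<lfloor>2 powr (b * real n)\<rfloor>)) + log 2 (real (nat \<lfloor>2 powr (c * real n)\<rfloor>)) - 1)"
      by (intro mult_left_mono omega_s_nonneg diff_right_mono add_mono floor_powr_bounds(4) assms)
    also have "\<dots> \<le> 3 * ?g n"
      by (intro omega_s_log_le_support_rank_mm floor_powr_bounds(1) assms)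
    finally show "?\<omega> * (a + b + c - 4 / real n) \<le> 3 * (?g n / real n)"
      using n by (simp add: pos_le_divide_eq)
  qed
qed

subsection \<open>Covering a box by random images\<close>

text \<open>Cauchy-Schwarz for the weighted number N of events that occur, summed over the union of
  the events, outside of which N vanishes.\<close>

lemma second_moment:
  fixes Q :: "'x \<Rightarrow> real"
  assumes fin: "finite \<Omega>" "finite A" and E: "\<And>x. x \<in> A \<Longrightarrow> E x \<subseteq> \<Omega>"
  shows "(\<Sum>x\<in>A. Q x * card (E x))\<^sup>2
    \<le> card (\<Union>x\<in>A. E x) * (\<Sum>x\<in>A. \<Sum>y\<in>A. Q x * Q y * card (E x \<inter> E y))"
proof -
  define N where "N \<omega> = (\<Sum>x\<in>A. Q x * of_bool (\<omega> \<in> E x))" for \<omega>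
  let ?U = "\<Union>x\<in>A. E x"
  have finU: "finite ?U" using fin E by (meson UN_least finite_subset)
  have card: "(\<Sum>\<omega>\<in>?U. of_bool (\<omega> \<in> S)) = real (card S)" if "S \<subseteq> ?U" for S
    using that finU by (simp add: Int_absorb1)
  have N: "(\<Sum>\<omega>\<in>?U. N \<omega>) = (\<Sum>x\<in>A. Q x * card (E x))"
  proof -
    have "(\<Sum>\<omega>\<in>?U. N \<omega>) = (\<Sum>x\<in>A. Q x * (\<Sum>\<omega>\<in>?U. of_bool (\<omega> \<in> E x)))"
      unfolding N_def sum_distrib_left by (rule sum.swap)
    also have "\<dots> = (\<Sum>x\<in>A. Q x * card (E x))"
      by (intro sum.cong refl arg_cong2[where f = "(*)"] card) blast
    finally show ?thesis .
  qed
  have N2: "(\<Sum>\<omega>\<in>?U. (N \<omega>)\<^sup>2) = (\<Sum>x\<in>A. \<Sum>y\<in>A. Q x * Q y * card (E x \<inter> E y))"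
  proof -
    have "(\<Sum>\<omega>\<in>?U. (N \<omega>)\<^sup>2) = (\<Sum>\<omega>\<in>?U. \<Sum>x\<in>A. \<Sum>y\<in>A. Q x * Q y * of_bool (\<omega> \<in> E x \<inter> E y))"
      unfolding N_def power2_eq_square sum_product by (intro sum.cong) auto
    also have "\<dots> = (\<Sum>x\<in>A. \<Sum>\<omega>\<in>?U. \<Sum>y\<in>A. Q x * Q y * of_bool (\<omega> \<in> E x \<inter> E y))"
      by (rule sum.swap)
    also have "\<dots> = (\<Sum>x\<in>A. \<Sum>y\<in>A. \<Sum>\<omega>\<in>?U. Q x * Q y * of_bool (\<omega> \<in> E x \<inter> E y))"
      by (intro sum.cong refl sum.swap)
    also have "\<dots> = (\<Sum>x\<in>A. \<Sum>y\<in>A. Q x * Q y * card (E x \<inter> E y))"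
      unfolding sum_distrib_left[symmetric]
      by (intro sum.cong refl arg_cong2[where f = "(*)"] card) blast
    finally show ?thesis .
  qed
  have "(\<Sum>\<omega>\<in>?U. N \<omega>)\<^sup>2 \<le> (\<Sum>\<omega>\<in>?U. (N \<omega>)\<^sup>2) * card ?U"
    by (rule sum_squared_le_sum_of_squares)
  then show ?thesis unfolding N N2 by (simp add: mult.commute)
qed

section \<open>Uniformly random functions\<close>

lemma card_PiE_prescribed:
  assumes "finite I" "finite L" "S \<subseteq> I" "y \<in> L"
  shows "card {f \<in> I \<rightarrow>\<^sub>E L. \<forall>x\<in>S. f x = y} * card L ^ card S = card (I \<rightarrow>\<^sub>E L)"
proof -
  have "{f \<in> I \<rightarrow>\<^sub>E L. \<forall>x\<in>S. f x = y} = (\<Pi>\<^sub>E x\<in>I. if x \<in> S then {y} else L)"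
  proof (intro subset_antisym subsetI)
    fix f assume f: "f \<in> (\<Pi>\<^sub>E x\<in>I. if x \<in> S then {y} else L)"
    then have *: "f x \<in> (if x \<in> S then {y} else L)" if "x \<in> I" for x using that by (rule PiE_mem)
    have "f x \<in> L" if "x \<in> I" for x using *[OF that] assms(4) by (simp split: if_splits)
    moreover have "f x = y" if "x \<in> S" for x using *[of x] that assms(3) by (simp add: subset_iff)
    ultimately show "f \<in> {f \<in> I \<rightarrow>\<^sub>E L. \<forall>x\<in>S. f x = y}" using f by (simp add: PiE_iff)
  qed (simp add: PiE_iff)
  then have "card {f \<in> I \<rightarrow>\<^sub>E L. \<forall>x\<in>S. f x = y} = (\<Prod>x\<in>I. card (if x \<in> S then {y} else L))"
    using assms by (simp add: card_PiE)
  also have "\<dots> = (\<Prod>x\<in>I. if x \<in> S then 1 else card L)" by (intro prod.cong) auto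
  also have "\<dots> = card L ^ card (I - S)"
    using assms by (simp add: prod.If_cases Diff_eq)
  finally show ?thesis
    using assms by (simp add: card_PiE card_Diff_subset finite_subset card_mono flip: power_add)
qed

lemma card_PiE_point:
  assumes "finite I" "finite L" "i \<in> I" "y \<in> L"
  shows "real (card {f \<in> I \<rightarrow>\<^sub>E L. f i = y}) = card (I \<rightarrow>\<^sub>E L) / card L"
proof -
  have "card L > 0" using assms card_gt_0_iff by blast
  moreover have "real (card {f \<in> I \<rightarrow>\<^sub>E L. f i = y} * card L) = card (I \<rightarrow>\<^sub>E L)"
    using card_PiE_prescribed[of I L "{i}" y] assms by simp
  ultimately show ?thesis by (simp add: field_simps)
qed

lemma card_PiE_two_points:
  assumes "finite I" "finite L" "i \<in> I" "i' \<in> I" "y \<in> L"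
  shows "real (card {f \<in> I \<rightarrow>\<^sub>E L. f i = y \<and> f i' = y})
    = card (I \<rightarrow>\<^sub>E L) / (card L)\<^sup>2 * (if i = i' then card L else 1)"
proof (cases "i = i'")
  case True
  then show ?thesis using card_PiE_point[OF assms(1-3,5)] assms
    by (simp add: power2_eq_square)
next
  case False
  have "card L > 0" using assms card_gt_0_iff by blast
  moreover have "real (card {f \<in> I \<rightarrow>\<^sub>E L. f i = y \<and> f i' = y} * (card L)\<^sup>2) = card (I \<rightarrow>\<^sub>E L)"
    using card_PiE_prescribed[of I L "{i, i'}" y] assms False by (simp add: numeral_2_eq_2)
  ultimately show ?thesis using False by (simp add: field_simps)
qed

text \<open>For independent uniform f, g, h one x hits the target with probability 1/(l m n), where
  l, m, n are the range sizes. Two of them hit it jointly with the square of this, times one range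
  size for each coordinate in which they coincide. The powers of l m n cancel.\<close>

lemma random_hit:
  fixes Q :: "'x \<Rightarrow> real" and p1 :: "'x \<Rightarrow> 'a" and p2 :: "'x \<Rightarrow> 'b" and p3 :: "'x \<Rightarrow> 'c"
  assumes fin: "finite A" "finite I" "finite J" "finite K" "finite L" "finite M" "finite N"
    and sub: "p1 ` A \<subseteq> I" "p2 ` A \<subseteq> J" "p3 ` A \<subseteq> K" and y: "y1 \<in> L" "y2 \<in> M" "y3 \<in> N"
  defines "\<Omega> \<equiv> (I \<rightarrow>\<^sub>E L) \<times> (J \<rightarrow>\<^sub>E M) \<times> (K \<rightarrow>\<^sub>E N)"
  shows "(\<Sum>x\<in>A. Q x)\<^sup>2 * card \<Omega>
    \<le> card {(f, g, h) \<in> \<Omega>. \<exists>x\<in>A. f (p1 x) = y1 \<and> g (p2 x) = y2 \<and> h (p3 x) = y3}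
      * (\<Sum>x\<in>A. \<Sum>x'\<in>A. Q x * Q x' * ((if p1 x = p1 x' then card L else 1)
          * (if p2 x = p2 x' then card M else 1) * (if p3 x = p3 x' then card N else 1)))"
    (is "_ \<le> real (card ?H) * ?S")
proof -
  let ?l = "real (card L)" and ?m = "real (card M)" and ?n = "real (card N)"
  have pos: "?l > 0" "?m > 0" "?n > 0" using fin y card_gt_0_iff by fastforce+
  have fin\<Omega>: "finite \<Omega>" unfolding \<Omega>_def using fin by (intro finite_cartesian_product finite_PiE) auto
  define E where "E x = {(f, g, h) \<in> \<Omega>. f (p1 x) = y1 \<and> g (p2 x) = y2 \<and> h (p3 x) = y3}" for x
  have card_E: "real (card (E x)) = card \<Omega> / (?l * ?m * ?n)" if "x \<in> A" for x
  proof -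
    have "E x = {f \<in> I \<rightarrow>\<^sub>E L. f (p1 x) = y1} \<times> {g \<in> J \<rightarrow>\<^sub>E M. g (p2 x) = y2} \<times> {h \<in> K \<rightarrow>\<^sub>E N. h (p3 x) = y3}"
      by (auto simp: E_def \<Omega>_def)
    moreover have "p1 x \<in> I" "p2 x \<in> J" "p3 x \<in> K" using sub that by auto
    ultimately show ?thesis
      using fin y by (simp add: card_cartesian_product card_PiE_point \<Omega>_def)
  qed
  have card_EE: "real (card (E x \<inter> E x')) = card \<Omega> / (?l * ?m * ?n)\<^sup>2 * ((if p1 x = p1 x' then card L else 1)
          * (if p2 x = p2 x' then card M else 1) * (if p3 x = p3 x' then card N else 1))"
    if "x \<in> A" "x' \<in> A" for x x'
  proof -
    have "E x \<inter> E x' = {f \<in> I \<rightarrow>\<^sub>E L. f (p1 x) = y1 \<and> f (p1 x') = y1}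
        \<times> {g \<in> J \<rightarrow>\<^sub>E M. g (p2 x) = y2 \<and> g (p2 x') = y2} \<times> {h \<in> K \<rightarrow>\<^sub>E N. h (p3 x) = y3 \<and> h (p3 x') = y3}"
      by (auto simp: E_def \<Omega>_def)
    moreover have "p1 x \<in> I" "p2 x \<in> J" "p3 x \<in> K" "p1 x' \<in> I" "p2 x' \<in> J" "p3 x' \<in> K"
      using sub that by auto
    ultimately have "real (card (E x \<inter> E x')) =
      (card (I \<rightarrow>\<^sub>E L) / ?l\<^sup>2 * (if p1 x = p1 x' then card L else 1))
      * ((card (J \<rightarrow>\<^sub>E M) / ?m\<^sup>2 * (if p2 x = p2 x' then card M else 1))
      * (card (K \<rightarrow>\<^sub>E N) / ?n\<^sup>2 * (if p3 x = p3 x' then card N else 1)))"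
      by (simp only: card_cartesian_product of_nat_mult of_nat_power card_PiE_two_points fin y)
    then show ?thesis
      by (simp add: \<Omega>_def card_cartesian_product power_mult_distrib mult_ac)
  qed
  have "(\<Union>x\<in>A. E x) = ?H" by (auto simp: E_def)
  with second_moment[OF fin\<Omega> fin(1), of E Q]
  have "(\<Sum>x\<in>A. Q x * card (E x))\<^sup>2 \<le> card ?H * (\<Sum>x\<in>A. \<Sum>y\<in>A. Q x * Q y * card (E x \<inter> E y))"
    by (force simp: E_def)
  also have "(\<Sum>x\<in>A. Q x * card (E x)) = (\<Sum>x\<in>A. Q x) * (card \<Omega> / (?l * ?m * ?n))"
    unfolding sum_distrib_right by (intro sum.cong) (auto simp: card_E)
  also have "(\<Sum>x\<in>A. \<Sum>y\<in>A. Q x * Q y * card (E x \<inter> E y)) = card \<Omega> / (?l * ?m * ?n)\<^sup>2 * ?S"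
    unfolding sum_distrib_left by (intro sum.cong refl) (simp only: card_EE, simp only: mult_ac)
  finally have *: "((\<Sum>x\<in>A. Q x) * (card \<Omega> / (?l * ?m * ?n)))\<^sup>2
      \<le> card ?H * (card \<Omega> / (?l * ?m * ?n)\<^sup>2 * ?S)" .
  let ?D = "(?l * ?m * ?n)\<^sup>2"
  have D: "?D > 0" using pos by simp
  have "((\<Sum>x\<in>A. Q x)\<^sup>2 * card \<Omega>) * (card \<Omega> / ?D) = ((\<Sum>x\<in>A. Q x) * (card \<Omega> / (?l * ?m * ?n)))\<^sup>2"
    by (simp add: power_mult_distrib power_divide power2_eq_square)
  also have "\<dots> \<le> (card ?H * ?S) * (card \<Omega> / ?D)" using * by (simp only: mult_ac)
  finally have **: "((\<Sum>x\<in>A. Q x)\<^sup>2 * card \<Omega>) * (card \<Omega> / ?D) \<le> (card ?H * ?S) * (card \<Omega> / ?D)" .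
  have "\<Omega> \<noteq> {}"
    unfolding \<Omega>_def using y by (auto simp: PiE_eq_empty_iff)
  then have "card \<Omega> / ?D > 0" using fin\<Omega> D by (simp add: card_gt_0_iff)
  with ** show ?thesis by (rule mult_right_le_imp_le)
qed

text \<open>If every point is hit with probability at least p, then for any set of points some
  \<omega> hits at least the share p of it. Applied repeatedly to the points still missed, this
  leaves at most the share (1 - p)^N.\<close>

lemma greedy_cover:
  fixes p :: real
  assumes fin: "finite \<Omega>" "\<Omega> \<noteq> {}" "finite U" and p: "p \<le> 1"
    and hit: "\<And>\<tau>. \<tau> \<in> U \<Longrightarrow> p * card \<Omega> \<le> card {\<omega> \<in> \<Omega>. \<tau> \<in> H \<omega>}"
  shows "\<exists>\<omega>s. (\<forall>i<N. \<omega>s i \<in> \<Omega>) \<and> card {\<tau> \<in> U. \<forall>i<N. \<tau> \<notin> H (\<omega>s i)} \<le> (1 - p) ^ N * card U"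
proof (induction N)
  case 0
  then show ?case by simp
next
  case (Suc N)
  then obtain \<omega>s where \<omega>s: "\<And>i. i < N \<Longrightarrow> \<omega>s i \<in> \<Omega>"
    "card {\<tau> \<in> U. \<forall>i<N. \<tau> \<notin> H (\<omega>s i)} \<le> (1 - p) ^ N * card U" by blast
  define V where "V = {\<tau> \<in> U. \<forall>i<N. \<tau> \<notin> H (\<omega>s i)}"
  have finV: "finite V" using fin by (simp add: V_def)
  \<comment> \<open>Double counting of the pairs of an \<omega> and a missed point that it
    hits.\<close>
  have "\<exists>\<omega>\<in>\<Omega>. p * card V \<le> card (V \<inter> H \<omega>)"
  proof (rule ccontr)
    assume "\<not> ?thesis"
    then have "(\<Sum>\<omega>\<in>\<Omega>. real (card (V \<inter> H \<omega>))) < (\<Sum>\<omega>\<in>\<Omega>. p * card V)"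
      using fin by (intro sum_strict_mono) (auto simp: not_le)
    also have "\<dots> = (\<Sum>\<tau>\<in>V. p * card \<Omega>)" by simp
    also have "\<dots> \<le> (\<Sum>\<tau>\<in>V. real (card {\<omega> \<in> \<Omega>. \<tau> \<in> H \<omega>}))"
      using hit by (intro sum_mono) (auto simp: V_def)
    also have "\<dots> = (\<Sum>\<tau>\<in>V. \<Sum>\<omega>\<in>\<Omega>. of_bool (\<tau> \<in> H \<omega>))"
      using fin by (simp add: Int_def)
    also have "\<dots> = (\<Sum>\<omega>\<in>\<Omega>. \<Sum>\<tau>\<in>V. of_bool (\<tau> \<in> H \<omega>))" by (rule sum.swap)
    also have "\<dots> = (\<Sum>\<omega>\<in>\<Omega>. real (card (V \<inter> H \<omega>)))" using finV by simp
    finally show False by simp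
  qed
  then obtain \<omega> where \<omega>: "\<omega> \<in> \<Omega>" "p * card V \<le> card (V \<inter> H \<omega>)" by blast
  have "{\<tau> \<in> U. \<forall>i<Suc N. \<tau> \<notin> H ((\<omega>s(N := \<omega>)) i)} = V - H \<omega>"
    by (auto simp: V_def less_Suc_eq)
  then have "real (card {\<tau> \<in> U. \<forall>i<Suc N. \<tau> \<notin> H ((\<omega>s(N := \<omega>)) i)}) = real (card V) - real (card (V \<inter> H \<omega>))"
    using finV card_mono[OF finV, of "V \<inter> H \<omega>"] by (simp add: card_Diff_subset_Int of_nat_diff)
  also have "\<dots> \<le> (1 - p) * card V" using \<omega>(2) by (simp add: algebra_simps)
  also have "\<dots> \<le> (1 - p) * ((1 - p) ^ N * card U)"
    using \<omega>s(2) p by (intro mult_left_mono) (auto simp: V_def)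
  finally have "real (card {\<tau> \<in> U. \<forall>i<Suc N. \<tau> \<notin> H ((\<omega>s(N := \<omega>)) i)}) \<le> (1 - p) ^ Suc N * card U"
    by (simp add: mult.assoc)
  moreover have "\<forall>i<Suc N. (\<omega>s(N := \<omega>)) i \<in> \<Omega>" using \<omega>s(1) \<omega>(1) by (simp add: less_Suc_eq)
  ultimately show ?case by blast
qed

text \<open>With N > ln |\<Psi>| / p greedy choices fewer than one point is missed, as 1 - p \<le>
  exp (-p). The sets must stay inside \<Psi>, since their union has to be exactly this
  support.\<close>

lemma support_rank_cover:
  fixes p :: real and \<Psi> :: "('a \<times> 'b \<times> 'c) set"
  assumes inf: "infinite (UNIV :: 'f::field set)"
    and fin: "finite \<Omega>" "\<Omega> \<noteq> {}" "finite \<Psi>" "\<Psi> \<noteq> {}" and p: "0 < p" "p \<le> 1"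
    and hit: "\<And>\<tau>. \<tau> \<in> \<Psi> \<Longrightarrow> p * card \<Omega> \<le> card {\<omega> \<in> \<Omega>. \<tau> \<in> H \<omega>}"
    and H: "\<And>\<omega>. \<omega> \<in> \<Omega> \<Longrightarrow> H \<omega> \<subseteq> \<Psi>" "\<And>\<omega>. \<omega> \<in> \<Omega> \<Longrightarrow> support_rank TYPE('f) (H \<omega>) \<le> r"
  shows "support_rank TYPE('f) \<Psi> \<le> (ln (card \<Psi>) / p + 2) * real r"
proof -
  have card\<Psi>: "card \<Psi> \<ge> 1" using fin by (simp add: Suc_le_eq card_gt_0_iff)
  define N where "N = nat \<lfloor>ln (card \<Psi>) / p\<rfloor> + 1"
  have "ln (card \<Psi>) / p \<ge> 0" using card\<Psi> p by simp
  then have N: "ln (card \<Psi>) / p < N" "N \<le> ln (card \<Psi>) / p + 2"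
    by (auto simp: N_def) linarith+
  obtain \<omega>s where \<omega>s: "\<And>i. i < N \<Longrightarrow> \<omega>s i \<in> \<Omega>"
    "card {\<tau> \<in> \<Psi>. \<forall>i<N. \<tau> \<notin> H (\<omega>s i)} \<le> (1 - p) ^ N * card \<Psi>"
    using greedy_cover[OF fin(1-3) p(2) hit, of N] by blast
  have "(1 - p) ^ N \<le> exp (- p) ^ N"
    using p exp_ge_add_one_self[of "- p"] by (intro power_mono) auto
  also have "\<dots> = exp (- (p * N))" by (simp add: exp_of_nat_mult[symmetric] mult.commute)
  also have "\<dots> < exp (- ln (card \<Psi>))" using N(1) p by (simp add: field_simps)
  also have "\<dots> = 1 / card \<Psi>" using card\<Psi> by (simp add: exp_minus inverse_eq_divide)
  finally have "(1 - p) ^ N * card \<Psi> < 1" using card\<Psi> by (simp add: field_simps)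
  with \<omega>s(2) have "card {\<tau> \<in> \<Psi>. \<forall>i<N. \<tau> \<notin> H (\<omega>s i)} = 0" by simp
  then have "{\<tau> \<in> \<Psi>. \<forall>i<N. \<tau> \<notin> H (\<omega>s i)} = {}" using fin by simp
  then have "\<Psi> = (\<Union>i<N. H (\<omega>s i))" using H(1) \<omega>s(1) by fastforce
  moreover have "support_rank TYPE('f) (\<Union>i<N. H (\<omega>s i)) \<le> N * r"
    using H(2) \<omega>s(1) by (intro support_rank_UN inf finite_subset[OF H(1) fin(3)]) auto
  ultimately have "real (support_rank TYPE('f) \<Psi>) \<le> real (N * r)"
    by (simp only: of_nat_le_iff)
  also have "\<dots> = real N * real r" by simp
  also have "\<dots> \<le> (ln (card \<Psi>) / p + 2) * real r" using N(2) by (rule mult_right_mono) simp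
  finally show ?thesis .
qed

subsection \<open>Typical sequences\<close>

text \<open>Exponential Markov bound for the upper tail of the mean of log c under P. The rate
  \<rho> is the moment function \<phi> at a small s > 0.\<close>

lemma chernoff:
  fixes P c :: "'x \<Rightarrow> real"
  assumes fin: "finite A" and P: "\<And>x. x \<in> A \<Longrightarrow> 0 \<le> P x" "(\<Sum>x\<in>A. P x) = 1"
    and c: "\<And>x. x \<in> A \<Longrightarrow> 0 \<le> c x" "\<And>x. x \<in> A \<Longrightarrow> 0 < P x \<Longrightarrow> 0 < c x"
    and \<delta>: "\<delta> > 0"
  obtains \<rho> :: real where "0 \<le> \<rho>" "\<rho> < 1"
    "\<And>n :: nat. (\<Sum>x\<in>{x \<in> {..<n} \<rightarrow>\<^sub>E A. (\<Prod>t<n. c (x t)) > (2 powr ((\<Sum>x\<in>A. P x * log 2 (c x)) + \<delta>)) ^ n}.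
        \<Prod>t<n. P (x t)) \<le> \<rho> ^ n"
proof -
  define e where "e = (\<Sum>x\<in>A. P x * log 2 (c x))"
  define K where "K = 2 powr (e + \<delta>)"
  have K: "K > 0" "ln K = (e + \<delta>) * ln 2" by (auto simp: K_def ln_powr)
  \<comment> \<open>Here \<phi>(0) = 1 and the derivative at 0 is the mean of ln (c/K), that is,
    -\<delta> ln 2 < 0, so \<phi> drops below 1 just to the right of 0.\<close>
  define \<phi> where "\<phi> s = (\<Sum>x\<in>A. P x * (c x / K) powr s)" for s
  have deriv: "((\<lambda>s. P x * (c x / K) powr s) has_real_derivative P x * ln (c x / K)) (at 0)"
    if "x \<in> A" for x
  proof (cases "P x = 0")
    case False
    then have "c x > 0" using P c that by force
    then have "(\<lambda>s. P x * (c x / K) powr s) = (\<lambda>s. P x * exp (s * ln (c x / K)))"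
      using K by (simp add: powr_def)
    then show ?thesis by (auto intro!: derivative_eq_intros)
  qed simp
  have "(\<phi> has_real_derivative (\<Sum>x\<in>A. P x * ln (c x / K))) (at 0)"
    unfolding \<phi>_def by (intro DERIV_sum deriv)
  moreover have "(\<Sum>x\<in>A. P x * ln (c x / K)) = - \<delta> * ln 2"
  proof -
    have "P x * ln (c x / K) = ln 2 * (P x * log 2 (c x)) - P x * ln K" if "x \<in> A" for x
    proof (cases "P x = 0")
      case False
      then have "c x > 0" using P c that by force
      then show ?thesis using K by (simp add: ln_div log_def algebra_simps)
    qed simp
    then have "(\<Sum>x\<in>A. P x * ln (c x / K)) = ln 2 * e - ln K"
      by (simp add: e_def sum_subtractf sum_distrib_left P flip: sum_distrib_right)
    then show ?thesis by (simp add: K algebra_simps)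
  qed
  ultimately have "(\<phi> has_real_derivative (- \<delta> * ln 2)) (at 0)" by simp
  moreover have "- \<delta> * ln 2 < 0" using \<delta> by simp
  ultimately obtain d where d: "d > 0" "\<And>h. h > 0 \<Longrightarrow> h < d \<Longrightarrow> \<phi> (0 + h) < \<phi> 0"
    using DERIV_neg_dec_right by blast
  \<comment> \<open>Since \<open>0 powr 0 = 0\<close>, this needs c x > 0 wherever P x > 0; the
    other terms vanish.\<close>
  have "\<phi> 0 = (\<Sum>x\<in>A. P x)"
    unfolding \<phi>_def using P c K by (intro sum.cong) (auto simp: less_le)
  then have \<phi>0: "\<phi> 0 = 1" using P by simp
  define s where "s = d / 2"
  have s: "s > 0" "\<phi> s < 1" using d(1) d(2)[of s] \<phi>0 by (auto simp: s_def)
  show ?thesis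
  proof (rule that)
    show "0 \<le> \<phi> s" unfolding \<phi>_def using P by (intro sum_nonneg) auto
    show "\<phi> s < 1" by (rule s)
    fix n :: nat
    let ?B = "{x \<in> {..<n} \<rightarrow>\<^sub>E A. (\<Prod>t<n. c (x t)) > K ^ n}"
    have finO: "finite ({..<n} \<rightarrow>\<^sub>E A)" using fin by (intro finite_PiE) auto
    have "(\<Sum>x\<in>?B. \<Prod>t<n. P (x t)) \<le> (\<Sum>x\<in>?B. \<Prod>t<n. P (x t) * (c (x t) / K) powr s)"
    proof (rule sum_mono)
      fix x assume x: "x \<in> ?B"
      then have xA: "x t \<in> A" if "t < n" for t using that by (auto simp: PiE_iff)
      \<comment> \<open>On the bad set the product of the c/K exceeds 1, so inserting its s-th power
        can only enlarge the mass.\<close>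
      have "1 \<le> (\<Prod>t<n. c (x t)) / K ^ n" using x K by simp
      also have "\<dots> = (\<Prod>t<n. c (x t) / K)" by (simp add: prod_dividef)
      finally have "1 \<le> (\<Prod>t<n. c (x t) / K) powr s" using s by (intro ge_one_powr_ge_zero) auto
      also have "\<dots> = (\<Prod>t<n. (c (x t) / K) powr s)"
        by (rule prod_powr_distrib)
      finally have "(\<Prod>t<n. P (x t)) * 1 \<le> (\<Prod>t<n. P (x t)) * (\<Prod>t<n. (c (x t) / K) powr s)"
        using xA P by (intro mult_left_mono prod_nonneg) auto
      then show "(\<Prod>t<n. P (x t)) \<le> (\<Prod>t<n. P (x t) * (c (x t) / K) powr s)"
        by (simp add: prod.distrib)
    qed
    also have "\<dots> \<le> (\<Sum>x\<in>{..<n} \<rightarrow>\<^sub>E A. \<Prod>t<n. P (x t) * (c (x t) / K) powr s)"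
      using P(1) by (intro sum_mono2 finO prod_nonneg mult_nonneg_nonneg) (auto dest: PiE_mem)
    also have "\<dots> = (\<Prod>t<n. \<phi> s)" unfolding \<phi>_def using fin by (subst prod_sum_PiE) auto
    finally show "(\<Sum>x\<in>{x \<in> {..<n} \<rightarrow>\<^sub>E A. (\<Prod>t<n. c (x t)) > (2 powr ((\<Sum>x\<in>A. P x * log 2 (c x)) + \<delta>)) ^ n}.
        \<Prod>t<n. P (x t)) \<le> \<phi> s ^ n"
      by (simp add: K_def e_def)
  qed
qed

text \<open>Union bound over finitely many Chernoff tails. One-sided typicality is enough, because
  collision probabilities have to be bounded only from above.\<close>

lemma typical_mass:
  fixes P :: "'x \<Rightarrow> real" and c :: "'s::finite \<Rightarrow> 'x \<Rightarrow> real"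
  assumes fin: "finite A" and P: "\<And>x. x \<in> A \<Longrightarrow> 0 \<le> P x" "(\<Sum>x\<in>A. P x) = 1"
    and c: "\<And>s x. x \<in> A \<Longrightarrow> 0 \<le> c s x" "\<And>s x. x \<in> A \<Longrightarrow> 0 < P x \<Longrightarrow> 0 < c s x"
    and \<delta>: "\<delta> > 0"
  shows "\<forall>\<^sub>F n :: nat in sequentially. 1 / 2 \<le> (\<Sum>x\<in>{x \<in> {..<n} \<rightarrow>\<^sub>E A. \<forall>s.
      (\<Prod>t<n. c s (x t)) \<le> (2 powr ((\<Sum>x\<in>A. P x * log 2 (c s x)) + \<delta>)) ^ n}. \<Prod>t<n. P (x t))"
proof -
  define Q where "Q n = (\<lambda>x. \<Prod>t<n. P (x t))" for n :: nat
  define B where "B n s = {x \<in> {..<n} \<rightarrow>\<^sub>E A.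
      (\<Prod>t<n. c s (x t)) > (2 powr ((\<Sum>x\<in>A. P x * log 2 (c s x)) + \<delta>)) ^ n}" for n :: nat and s
  have "\<forall>s. \<exists>\<rho>. 0 \<le> \<rho> \<and> \<rho> < 1 \<and> (\<forall>n. sum (Q n) (B n s) \<le> \<rho> ^ n)"
  proof
    fix s
    show "\<exists>\<rho>. 0 \<le> \<rho> \<and> \<rho> < 1 \<and> (\<forall>n. sum (Q n) (B n s) \<le> \<rho> ^ n)"
    proof (rule chernoff[OF fin P c[where s = s] \<delta>])
      fix \<rho> :: real
      assume \<rho>: "0 \<le> \<rho>" "\<rho> < 1" and "\<And>n. (\<Sum>x\<in>{x \<in> {..<n} \<rightarrow>\<^sub>E A. (\<Prod>t<n. c s (x t)) >
        (2 powr ((\<Sum>x\<in>A. P x * log 2 (c s x)) + \<delta>)) ^ n}. \<Prod>t<n. P (x t)) \<le> \<rho> ^ n"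
      then have "sum (Q n) (B n s) \<le> \<rho> ^ n" for n by (simp only: Q_def B_def)
      with \<rho> show ?thesis by blast
    qed
  qed
  from choice[OF this] obtain \<rho> :: "'s \<Rightarrow> real" where
    \<rho>: "\<And>s. 0 \<le> \<rho> s" "\<And>s. \<rho> s < 1" "\<And>s n. sum (Q n) (B n s) \<le> \<rho> s ^ n" by blast
  have "(\<lambda>n. \<Sum>s\<in>UNIV. \<rho> s ^ n) \<longlonglongrightarrow> (\<Sum>s\<in>(UNIV :: 's set). 0)"
    using \<rho> by (intro tendsto_sum LIMSEQ_realpow_zero) auto
  then have "\<forall>\<^sub>F n in sequentially. (\<Sum>s\<in>UNIV. \<rho> s ^ n) < 1 / 2"
    by (intro order_tendstoD) auto
  then show ?thesis
  proof eventually_elim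
    case (elim n)
    let ?O = "{..<n} \<rightarrow>\<^sub>E A"
    let ?G = "{x \<in> ?O. \<forall>s. (\<Prod>t<n. c s (x t)) \<le> (2 powr ((\<Sum>x\<in>A. P x * log 2 (c s x)) + \<delta>)) ^ n}"
    have finO: "finite ?O" using fin by (intro finite_PiE) auto
    have Q0: "Q n x \<ge> 0" if "x \<in> ?O" for x
      unfolding Q_def using that P by (intro prod_nonneg) (auto simp: PiE_iff)
    have "1 = (\<Prod>t<n. \<Sum>x\<in>A. P x)" by (simp add: P)
    also have "\<dots> = sum (Q n) ?O" unfolding Q_def using fin by (subst prod_sum_PiE) auto
    also have "\<dots> \<le> (\<Sum>x\<in>?O. Q n x * of_bool (x \<in> ?G) + (\<Sum>s\<in>UNIV. Q n x * of_bool (x \<in> B n s)))"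
    proof (rule sum_mono)
      fix x assume x: "x \<in> ?O"
      show "Q n x \<le> Q n x * of_bool (x \<in> ?G) + (\<Sum>s\<in>UNIV. Q n x * of_bool (x \<in> B n s))"
      proof (cases "x \<in> ?G")
        case True
        have "0 \<le> (\<Sum>s\<in>UNIV. Q n x * of_bool (x \<in> B n s))" by (intro sum_nonneg) (simp add: Q0 x)
        then show ?thesis using True by simp
      next
        case False
        then obtain s where "x \<in> B n s" using x by (auto simp: B_def not_le)
        then have "Q n x \<le> (\<Sum>s\<in>UNIV. Q n x * of_bool (x \<in> B n s))"
          using member_le_sum[of s UNIV "\<lambda>s. Q n x * of_bool (x \<in> B n s)"] Q0[OF x] by simp
        moreover have "of_bool (x \<in> ?G) = (0 :: real)" using False by simp
        ultimately show ?thesis by (simp only: mult_zero_right add_0_left)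
      qed
    qed
    also have "\<dots> = (\<Sum>x\<in>?O. Q n x * of_bool (x \<in> ?G)) + (\<Sum>s\<in>UNIV. \<Sum>x\<in>?O. Q n x * of_bool (x \<in> B n s))"
      unfolding sum.distrib by (intro arg_cong2[where f = "(+)"] refl sum.swap)
    also have "\<dots> = sum (Q n) ?G + (\<Sum>s\<in>UNIV. sum (Q n) (B n s))"
    proof -
      have *: "(\<Sum>x\<in>?O. Q n x * of_bool (x \<in> S)) = sum (Q n) S" if "S \<subseteq> ?O" for S
        using that finO by (intro sum.mono_neutral_cong_right) auto
      have "?G \<subseteq> ?O" "\<And>s. B n s \<subseteq> ?O" by (auto simp: B_def)
      then show ?thesis by (simp only: *)
    qed
    also have "(\<Sum>s\<in>UNIV. sum (Q n) (B n s)) \<le> (\<Sum>s\<in>UNIV. \<rho> s ^ n)" by (intro sum_mono \<rho>)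
    finally show ?case using elim by (simp add: Q_def)
  qed
qed

subsection \<open>The upper bound on the rectangular exponent\<close>

lemma supp_pow_mm_supp:
  "supp_pow n (mm_supp \<Lambda>) = (\<lambda>x. (map (\<lambda>t. (fst (x t), fst (snd (x t)))) [0..<n],
      map (\<lambda>t. (fst (snd (x t)), snd (snd (x t)))) [0..<n],
      map (\<lambda>t. (snd (snd (x t)), fst (x t))) [0..<n])) ` ({..<n} \<rightarrow>\<^sub>E \<Lambda>)" (is "_ = ?F ` _")
proof (intro subset_antisym subsetI)
  fix z assume "z \<in> supp_pow n (mm_supp \<Lambda>)"
  then obtain as bs cs where z: "z = (as, bs, cs)" "length as = n" "length bs = n" "length cs = n"
    and mem: "\<And>l. l < n \<Longrightarrow> (as ! l, bs ! l, cs ! l) \<in> mm_supp \<Lambda>"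
    by (auto simp: supp_pow_def)
  define x where "x = restrict (\<lambda>t. (fst (as ! t), snd (as ! t), snd (bs ! t))) {..<n}"
  have x: "x t \<in> \<Lambda> \<and> as ! t = (fst (x t), fst (snd (x t))) \<and> bs ! t = (fst (snd (x t)), snd (snd (x t)))
      \<and> cs ! t = (snd (snd (x t)), fst (x t))" if "t < n" for t
    using mem[OF that] that by (auto simp: x_def mm_supp_def)
  then have "x \<in> {..<n} \<rightarrow>\<^sub>E \<Lambda>" by (auto simp: x_def)
  moreover have "z = ?F x" unfolding z(1) using z(2-4) x by (auto intro!: nth_equalityI)
  ultimately show "z \<in> ?F ` ({..<n} \<rightarrow>\<^sub>E \<Lambda>)" by blast
next
  fix z assume "z \<in> ?F ` ({..<n} \<rightarrow>\<^sub>E \<Lambda>)"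
  then obtain x where x: "x \<in> {..<n} \<rightarrow>\<^sub>E \<Lambda>" "z = ?F x" by blast
  have "((fst (x l), fst (snd (x l))), (fst (snd (x l)), snd (snd (x l))), (snd (snd (x l)), fst (x l)))
      \<in> mm_supp \<Lambda>" if "l < n" for l
  proof -
    have "x l \<in> \<Lambda>" using x(1) that by (auto dest: PiE_mem)
    then show ?thesis unfolding mm_supp_eq_image by (intro image_eqI[of _ _ "x l"]) (auto split: prod.splits)
  qed
  then show "z \<in> supp_pow n (mm_supp \<Lambda>)" unfolding x(2) supp_pow_def by simp
qed

text \<open>The triple s encodes a subset of the three factors. As a finite type with eight elements
  it allows sums over all subsets.\<close>

definition agree :: "bool \<times> bool \<times> bool \<Rightarrow> 'i \<times> 'j \<times> 'k \<Rightarrow> 'i \<times> 'j \<times> 'k \<Rightarrow> bool" where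
  "agree s x y \<longleftrightarrow> (fst s \<longrightarrow> fst x = fst y) \<and> (fst (snd s) \<longrightarrow> fst (snd x) = fst (snd y))
    \<and> (snd (snd s) \<longrightarrow> snd (snd x) = snd (snd y))"

definition select_sum :: "bool \<times> bool \<times> bool \<Rightarrow> real \<Rightarrow> real \<Rightarrow> real \<Rightarrow> real" where
  "select_sum s a b c = (if fst s then a else 0) + (if fst (snd s) then b else 0)
    + (if snd (snd s) then c else 0)"

text \<open>The factor 32 * 2^(\<delta> n) is the inverse of the hitting probability, the linear
  factor bounds the logarithm of the number of points to cover, and the last factor bounds the rank
  of a single image.\<close>

lemma support_rank_mm_box_le:
  fixes \<Lambda> :: "('i \<times> 'j \<times> 'k) set" and P :: "'i \<times> 'j \<times> 'k \<Rightarrow> real"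
  assumes inf: "infinite (UNIV :: 'f::field set)" and fin: "finite \<Lambda>"
    and P: "\<And>x. x \<in> \<Lambda> \<Longrightarrow> 0 \<le> P x" "(\<Sum>x\<in>\<Lambda>. P x) = 1"
    and abc: "a \<ge> 0" "b \<ge> 0" "c \<ge> 0"
    and ent: "\<And>s. select_sum s a b c \<le> - (\<Sum>x\<in>\<Lambda>. P x * log 2 (\<Sum>y\<in>{y \<in> \<Lambda>. agree s x y}. P y))"
    and \<delta>: "\<delta> > 0"
  shows "\<forall>\<^sub>F n :: nat in sequentially. real (support_rank TYPE('f) (mm_supp
      (mm_box (nat \<lfloor>2 powr (a * real n)\<rfloor>) (nat \<lfloor>2 powr (b * real n)\<rfloor>) (nat \<lfloor>2 powr (c * real n)\<rfloor>))))
    \<le> 32 * 2 powr (\<delta> * real n) * ((a + b + c) * real n + 2) * real (support_rank TYPE('f) (supp_pow n (mm_supp \<Lambda>)))"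
proof -
  \<comment> \<open>The probability that an independent sample from P agrees with x on s. The mean
    of its negative logarithm is the marginal entropy belonging to s.\<close>
  define q where "q s x = (\<Sum>y\<in>{y \<in> \<Lambda>. agree s x y}. P y)" for s x
  have q0: "q s x \<ge> 0" for s x unfolding q_def by (intro sum_nonneg) (auto simp: P)
  have q_pos: "q s x > 0" if "x \<in> \<Lambda>" "P x > 0" for s x
  proof -
    have "P x \<le> q s x" unfolding q_def
      using that fin P by (intro member_le_sum) (auto simp: agree_def)
    then show ?thesis using that by simp
  qed
  have "\<forall>\<^sub>F n :: nat in sequentially. 1 / 2 \<le> (\<Sum>x\<in>{x \<in> {..<n} \<rightarrow>\<^sub>E \<Lambda>. \<forall>s.
      (\<Prod>t<n. q s (x t)) \<le> (2 powr ((\<Sum>x\<in>\<Lambda>. P x * log 2 (q s x)) + \<delta>)) ^ n}. \<Prod>t<n. P (x t))"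
    by (rule typical_mass) (use fin P q0 q_pos \<delta> in blast)+
  then show ?thesis
  proof eventually_elim
    case (elim n)
    define O' where "O' = {..<n} \<rightarrow>\<^sub>E \<Lambda>"
    define G where "G = {x \<in> O'. \<forall>s. (\<Prod>t<n. q s (x t)) \<le> (2 powr ((\<Sum>x\<in>\<Lambda>. P x * log 2 (q s x)) + \<delta>)) ^ n}"
    define Q where "Q x = (\<Prod>t<n. P (x t))" for x
    have mass: "1 / 2 \<le> sum Q G" using elim by (simp add: Q_def G_def O'_def)
    have finO: "finite O'" unfolding O'_def using fin by (intro finite_PiE) auto
    have GO: "G \<subseteq> O'" by (auto simp: G_def)
    have finG: "finite G" using finite_subset[OF GO finO] .
    have Q0: "Q x \<ge> 0" if "x \<in> O'" for x
      unfolding Q_def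
    proof (intro prod_nonneg ballI P(1))
      show "x t \<in> \<Lambda>" if "t \<in> {..<n}" for t
        using PiE_mem[OF \<open>x \<in> O'\<close>[unfolded O'_def] that] .
    qed
    have "sum Q G \<le> sum Q O'" using GO finO Q0 by (intro sum_mono2) auto
    also have "\<dots> = (\<Prod>t<n. \<Sum>x\<in>\<Lambda>. P x)"
      unfolding Q_def O'_def using fin by (subst prod_sum_PiE) auto
    finally have mass1: "sum Q G \<le> 1" using P by simp
    define l m k where "l = nat \<lfloor>2 powr (a * real n)\<rfloor>" and "m = nat \<lfloor>2 powr (b * real n)\<rfloor>"
      and "k = nat \<lfloor>2 powr (c * real n)\<rfloor>"
    note lmk_defs = l_def m_def k_def
    have lmk: "l \<ge> 1" "m \<ge> 1" "k \<ge> 1" "real l \<le> 2 powr (a * real n)" "real m \<le> 2 powr (b * real n)"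
      "real k \<le> 2 powr (c * real n)"
      unfolding lmk_defs by (intro floor_powr_bounds abc)+
    define p1 p2 p3 where "p1 x = map (\<lambda>t. fst (x t)) [0..<n]"
      and "p2 x = map (\<lambda>t. fst (snd (x t))) [0..<n]" and "p3 x = map (\<lambda>t. snd (snd (x t))) [0..<n]"
    for x :: "nat \<Rightarrow> 'i \<times> 'j \<times> 'k"
    define w where "w s = (if fst s then real l else 1) * (if fst (snd s) then real m else 1)
        * (if snd (snd s) then real k else 1)" for s :: "bool \<times> bool \<times> bool"
    have w0: "w s \<ge> 0" for s by (simp add: w_def)
    have w_le: "w s \<le> 2 powr (select_sum s a b c * real n)" for s
    proof -
      have "w s \<le> (if fst s then 2 powr (a * real n) else 1) * (if fst (snd s) then 2 powr (b * real n) else 1)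
          * (if snd (snd s) then 2 powr (c * real n) else 1)"
        unfolding w_def using lmk by (intro mult_mono) auto
      also have "\<dots> = 2 powr (select_sum s a b c * real n)"
        by (simp add: select_sum_def powr_add algebra_simps)
      finally show ?thesis .
    qed
    have agree_iff: "(\<forall>t<n. agree s (x t) (y t)) \<longleftrightarrow> (fst s \<longrightarrow> p1 x = p1 y) \<and> (fst (snd s) \<longrightarrow> p2 x = p2 y)
        \<and> (snd (snd s) \<longrightarrow> p3 x = p3 y)" for s x y
      unfolding p1_def p2_def p3_def agree_def by (auto simp: map_eq_conv)
    \<comment> \<open>Dropping typicality of y leaves the product measure of a product set, which is
      the product of the \<open>q s (x t)\<close>. Typicality of x bounds this product, and
      \<open>ent\<close> cancels it against \<open>w s\<close>.\<close>
    have collision: "(\<Sum>y\<in>G. Q y * of_bool (\<forall>t<n. agree s (x t) (y t))) * w s \<le> 2 powr (\<delta> * real n)"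
      if x: "x \<in> G" for x s
    proof -
      let ?C = "({..<n} \<rightarrow>\<^sub>E \<Lambda>) \<inter> {y. \<forall>t<n. agree s (x t) (y t)}"
      have C: "?C = (\<Pi>\<^sub>E t\<in>{..<n}. {y \<in> \<Lambda>. agree s (x t) y})" by (auto simp: PiE_iff)
      have "(\<Sum>y\<in>G. Q y * of_bool (\<forall>t<n. agree s (x t) (y t)))
          \<le> (\<Sum>y\<in>O'. Q y * of_bool (\<forall>t<n. agree s (x t) (y t)))"
        using GO finO Q0 by (intro sum_mono2) auto
      also have "\<dots> = sum Q ?C"
        unfolding O'_def[symmetric] using finO by (intro sum.mono_neutral_cong_right) auto
      also have "\<dots> = (\<Prod>t<n. q s (x t))"
        unfolding C Q_def q_def using fin by (subst prod_sum_PiE) auto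
      also have "\<dots> \<le> (2 powr ((\<Sum>x\<in>\<Lambda>. P x * log 2 (q s x)) + \<delta>)) ^ n"
        using x unfolding G_def by blast
      also have "\<dots> = 2 powr (((\<Sum>x\<in>\<Lambda>. P x * log 2 (q s x)) + \<delta>) * real n)"
        by (simp add: powr_powr flip: powr_realpow)
      also have "\<dots> \<le> 2 powr ((- select_sum s a b c + \<delta>) * real n)"
        using ent[of s] by (intro powr_mono mult_right_mono) (auto simp: q_def)
      finally have "(\<Sum>y\<in>G. Q y * of_bool (\<forall>t<n. agree s (x t) (y t))) * w s
          \<le> 2 powr ((- select_sum s a b c + \<delta>) * real n) * 2 powr (select_sum s a b c * real n)"
        using w_le w0 by (intro mult_mono) auto
      also have "\<dots> = 2 powr (\<delta> * real n)" by (simp add: powr_add[symmetric] algebra_simps)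
      finally show ?thesis .
    qed
    define W where "W x y = (if p1 x = p1 y then card {1..l} else 1) * (if p2 x = p2 y then card {1..m} else 1)
        * (if p3 x = p3 y then card {1..k} else 1)" for x y
    \<comment> \<open>The set of coordinates in which x and y coincide already contributes the whole
      weight; the terms of the other s are nonnegative.\<close>
    have W_le: "real (W x y) \<le> (\<Sum>s\<in>UNIV. w s * of_bool (\<forall>t<n. agree s (x t) (y t)))" for x y
    proof -
      let ?s = "(p1 x = p1 y, p2 x = p2 y, p3 x = p3 y)"
      have "real (W x y) = w ?s * of_bool (\<forall>t<n. agree ?s (x t) (y t))"
        unfolding agree_iff by (simp add: W_def w_def)
      also have "\<dots> \<le> (\<Sum>s\<in>UNIV. w s * of_bool (\<forall>t<n. agree s (x t) (y t)))"
        using w0 by (intro member_le_sum) auto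
      finally show ?thesis .
    qed
    have "(\<Sum>x\<in>G. \<Sum>y\<in>G. Q x * Q y * W x y)
        \<le> (\<Sum>x\<in>G. \<Sum>y\<in>G. Q x * Q y * (\<Sum>s\<in>UNIV. w s * of_bool (\<forall>t<n. agree s (x t) (y t))))"
      using GO Q0 by (intro sum_mono mult_left_mono W_le mult_nonneg_nonneg) auto
    also have "\<dots> = (\<Sum>x\<in>G. \<Sum>y\<in>G. \<Sum>s\<in>UNIV. Q x * (Q y * of_bool (\<forall>t<n. agree s (x t) (y t)) * w s))"
      by (simp only: sum_distrib_left mult_ac)
    also have "\<dots> = (\<Sum>x\<in>G. \<Sum>s\<in>UNIV. \<Sum>y\<in>G. Q x * (Q y * of_bool (\<forall>t<n. agree s (x t) (y t)) * w s))"
      by (intro sum.cong refl sum.swap)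
    also have "\<dots> = (\<Sum>x\<in>G. \<Sum>s\<in>UNIV. Q x * ((\<Sum>y\<in>G. Q y * of_bool (\<forall>t<n. agree s (x t) (y t))) * w s))"
      by (simp only: sum_distrib_left sum_distrib_right)
    also have "\<dots> \<le> (\<Sum>x\<in>G. \<Sum>s\<in>(UNIV :: (bool \<times> bool \<times> bool) set). Q x * 2 powr (\<delta> * real n))"
      using GO Q0 by (intro sum_mono mult_left_mono collision) auto
    also have "\<dots> = 8 * 2 powr (\<delta> * real n) * sum Q G"
    proof -
      have "card (UNIV :: (bool \<times> bool \<times> bool) set) = 8" by (simp add: card_UNIV_bool)
      then show ?thesis by (simp add: sum_distrib_right mult_ac)
    qed
    also have "\<dots> \<le> 8 * 2 powr (\<delta> * real n) * 1" using mass1 by (intro mult_left_mono) auto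
    finally have S: "(\<Sum>x\<in>G. \<Sum>y\<in>G. Q x * Q y * W x y) \<le> 8 * 2 powr (\<delta> * real n)" by simp
    define \<Omega> where "\<Omega> = (p1 ` O' \<rightarrow>\<^sub>E {1..l}) \<times> (p2 ` O' \<rightarrow>\<^sub>E {1..m}) \<times> (p3 ` O' \<rightarrow>\<^sub>E {1..k})"
    have fin\<Omega>: "finite \<Omega>" unfolding \<Omega>_def using finO by (intro finite_cartesian_product finite_PiE) auto
    have "\<Omega> \<noteq> {}" unfolding \<Omega>_def using lmk by (auto simp: PiE_eq_empty_iff)
    \<comment> \<open>The substitutions act on whole sequences of length n, not letter by
      letter.\<close>
    define H where "H = (\<lambda>(f :: 'i list \<Rightarrow> nat, g :: 'j list \<Rightarrow> nat, h :: 'k list \<Rightarrow> nat).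
      (\<lambda>(as, bs, cs). ((f (map fst as), g (map snd as)), (g (map fst bs), h (map snd bs)),
        (h (map fst cs), f (map snd cs)))) ` supp_pow n (mm_supp \<Lambda>))"
    have H_eq: "H (f, g, h) = (\<lambda>x. ((f (p1 x), g (p2 x)), (g (p2 x), h (p3 x)), (h (p3 x), f (p1 x)))) ` O'"
      for f g h
      unfolding H_def supp_pow_mm_supp O'_def p1_def p2_def p3_def by (simp add: image_image o_def)
    \<comment> \<open>32 = 4 * 8: the typical mass 1/2 enters squared, and there are eight collision
      patterns.\<close>
    define p where "p = 1 / (32 * 2 powr (\<delta> * real n))"
    have ge1: "2 powr (\<delta> * real n) \<ge> 1" using \<delta> by (intro ge_one_powr_ge_zero) auto
    then have p: "0 < p" "p \<le> 1" by (auto simp: p_def)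
    let ?\<Psi> = "mm_supp (mm_box l m k)"
    have fin\<Psi>: "finite ?\<Psi>" by (simp add: mm_supp_eq_image mm_box_def)
    have "?\<Psi> \<noteq> {}" using lmk by (simp add: mm_supp_eq_image mm_box_def)
    have hit: "p * card \<Omega> \<le> card {\<omega> \<in> \<Omega>. \<tau> \<in> H \<omega>}" if mem: "\<tau> \<in> ?\<Psi>" for \<tau>
    proof -
      obtain y1 y2 y3 where \<tau>: "\<tau> = ((y1, y2), (y2, y3), (y3, y1))" "y1 \<in> {1..l}" "y2 \<in> {1..m}" "y3 \<in> {1..k}"
        using mem by (auto simp: mm_supp_def mm_box_def)
      let ?H = "{(f, g, h) \<in> \<Omega>. \<exists>x\<in>G. f (p1 x) = y1 \<and> g (p2 x) = y2 \<and> h (p3 x) = y3}"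
      \<comment> \<open>Only hits by typical sequences are counted, but a hit by any sequence puts
        the point into the image.\<close>
      have sub: "?H \<subseteq> {\<omega> \<in> \<Omega>. \<tau> \<in> H \<omega>}" using GO by (auto simp: H_eq \<tau>(1))
      have "(1 / 2)\<^sup>2 * real (card \<Omega>) \<le> (sum Q G)\<^sup>2 * card \<Omega>"
        using mass by (intro mult_right_mono power_mono) auto
      also have "\<dots> \<le> card ?H * (\<Sum>x\<in>G. \<Sum>y\<in>G. Q x * Q y * W x y)"
        unfolding W_def \<Omega>_def using GO finO finG \<tau> by (intro random_hit) auto
      also have "\<dots> \<le> card ?H * (8 * 2 powr (\<delta> * real n))" using S by (intro mult_left_mono) auto
      finally have "p * card \<Omega> \<le> card ?H" by (simp add: p_def field_simps power2_eq_square)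
      also have "\<dots> \<le> card {\<omega> \<in> \<Omega>. \<tau> \<in> H \<omega>}"
        using fin\<Omega> by (intro of_nat_mono card_mono[OF _ sub]) auto
      finally show ?thesis .
    qed
    have H_sub: "H \<omega> \<subseteq> ?\<Psi>" if "\<omega> \<in> \<Omega>" for \<omega>
    proof -
      obtain f g h where \<omega>: "\<omega> = (f, g, h)" by (metis prod_cases3)
      then have "f (p1 x) \<in> {1..l} \<and> g (p2 x) \<in> {1..m} \<and> h (p3 x) \<in> {1..k}" if "x \<in> O'" for x
        using that \<open>\<omega> \<in> \<Omega>\<close> by (auto simp only: \<Omega>_def mem_Times_iff fst_conv snd_conv dest: PiE_mem[OF _ imageI])
      then show ?thesis unfolding \<omega> H_eq mm_box_def by (auto simp: mem_mm_supp_box)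
    qed
    have H_rank: "support_rank TYPE('f) (H \<omega>) \<le> support_rank TYPE('f) (supp_pow n (mm_supp \<Lambda>))" for \<omega>
    proof -
      obtain f g h where \<omega>: "\<omega> = (f, g, h)" by (metis prod_cases3)
      have "finite (supp_pow n (mm_supp \<Lambda>))" using fin by (intro finite_supp_pow finite_mm_supp)
      from support_rank_image[OF inf this, of "\<lambda>as. (f (map fst as), g (map snd as))"
          "\<lambda>bs. (g (map fst bs), h (map snd bs))" "\<lambda>cs. (h (map fst cs), f (map snd cs))"]
      show ?thesis unfolding \<omega> H_def by simp
    qed
    have "real (support_rank TYPE('f) ?\<Psi>)
        \<le> (ln (card ?\<Psi>) / p + 2) * real (support_rank TYPE('f) (supp_pow n (mm_supp \<Lambda>)))"
      by (rule support_rank_cover[OF inf fin\<Omega> \<open>\<Omega> \<noteq> {}\<close> fin\<Psi> \<open>?\<Psi> \<noteq> {}\<close> p hit H_sub H_rank])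
    also have "\<dots> \<le> (((a + b + c) * real n + 2) / p) * real (support_rank TYPE('f) (supp_pow n (mm_supp \<Lambda>)))"
    proof (rule mult_right_mono)
      have "card ?\<Psi> \<le> card (mm_box l m k)"
        unfolding mm_supp_eq_image by (intro card_image_le) (simp add: mm_box_def)
      also have "\<dots> = l * (m * k)" by (simp add: mm_box_def card_cartesian_product)
      finally have "real (card ?\<Psi>) \<le> real l * (real m * real k)" by (metis of_nat_le_iff of_nat_mult)
      also have "\<dots> \<le> 2 powr (a * real n) * (2 powr (b * real n) * 2 powr (c * real n))"
        using lmk by (intro mult_mono) auto
      also have "\<dots> = 2 powr ((a + b + c) * real n)" by (simp add: powr_add algebra_simps)
      finally have "ln (real (card ?\<Psi>)) \<le> ln (2 powr ((a + b + c) * real n))"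
        using fin\<Psi> \<open>?\<Psi> \<noteq> {}\<close> by (intro ln_mono) (auto simp: card_gt_0_iff)
      also have "\<dots> = (a + b + c) * real n * ln 2" by (simp add: ln_powr)
      also have "\<dots> \<le> (a + b + c) * real n * 1"
        using abc ln_le_minus_one[of 2] by (intro mult_left_mono) auto
      finally have "ln (card ?\<Psi>) / p \<le> (a + b + c) * real n / p" using p by (simp add: divide_right_mono)
      moreover have "2 \<le> 2 / p" using p by (simp add: field_simps)
      ultimately show "ln (card ?\<Psi>) / p + 2 \<le> ((a + b + c) * real n + 2) / p"
        by (simp add: add_divide_distrib)
    qed simp
    finally show ?case unfolding lmk_defs by (simp add: p_def mult_ac)
  qed
qed

section \<open>Passing to the asymptotic support rank\<close>

lemma support_rank_supp_pow_add:
  assumes "finite \<Phi>"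
  shows "support_rank TYPE('f::field) (supp_pow (m + n) \<Phi>)
    \<le> support_rank TYPE('f) (supp_pow m \<Phi>) * support_rank TYPE('f) (supp_pow n \<Phi>)"
proof -
  have fin: "finite (supp_pow m \<Phi>)" "finite (supp_pow n \<Phi>)" using assms by (auto intro: finite_supp_pow)
  let ?L = "{xs. length xs = m + n}" and ?u = "\<lambda>xs. (take m xs, drop m xs)"
  have "support_rank TYPE('f) (supp_pow (m + n) \<Phi>)
      \<le> support_rank TYPE('f) (prod_supp (supp_pow m \<Phi>) (supp_pow n \<Phi>))"
  proof (rule support_rank_pullback)
    show "finite (prod_supp (supp_pow m \<Phi>) (supp_pow n \<Phi>))" using fin by (rule finite_prod_supp)
    have split: "(\<forall>l<m + n. R l) \<longleftrightarrow> (\<forall>l<m. R l) \<and> (\<forall>l<n. R (m + l))" for R :: "nat \<Rightarrow> bool"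
      by (metis add_diff_inverse_nat nat_add_left_cancel_less trans_less_add1)
    show "supp_pow (m + n) \<Phi> = {(as, bs, cs). as \<in> ?L \<and> bs \<in> ?L \<and> cs \<in> ?L \<and>
        (?u as, ?u bs, ?u cs) \<in> prod_supp (supp_pow m \<Phi>) (supp_pow n \<Phi>)}"
      unfolding supp_pow_def prod_supp_def split by auto
  qed
  also have "\<dots> \<le> support_rank TYPE('f) (supp_pow m \<Phi>) * support_rank TYPE('f) (supp_pow n \<Phi>)"
    using fin by (rule support_rank_prod_supp)
  finally show ?thesis .
qed

lemma support_rank_supp_pow_mult:
  assumes "finite \<Phi>" "q \<ge> 1"
  shows "support_rank TYPE('f::field) (supp_pow (m * q) \<Phi>) \<le> support_rank TYPE('f) (supp_pow m \<Phi>) ^ q"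
  using assms(2)
proof (induction q rule: dec_induct)
  case (step q)
  have "support_rank TYPE('f) (supp_pow (m * Suc q) \<Phi>)
      \<le> support_rank TYPE('f) (supp_pow m \<Phi>) * support_rank TYPE('f) (supp_pow (m * q) \<Phi>)"
    using support_rank_supp_pow_add[OF assms(1)] by (simp add: algebra_simps)
  also have "\<dots> \<le> support_rank TYPE('f) (supp_pow m \<Phi>) * support_rank TYPE('f) (supp_pow m \<Phi>) ^ q"
    using step by (intro mult_left_mono) auto
  finally show ?case by simp
qed simp

text \<open>The asymptotic rank is defined as an infimum, so each power m has to be treated. Along n
  = m q the n-th power costs at most the q-th power of the rank for m; q tends to infinity with
  \<delta> fixed, and then \<delta> is arbitrary.\<close>

lemma omega_s_abc_le_log_asymp:
  fixes \<Lambda> :: "('i \<times> 'j \<times> 'k) set" and P :: "'i \<times> 'j \<times> 'k \<Rightarrow> real"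
  assumes inf: "infinite (UNIV :: 'f::field set)" and fin: "finite \<Lambda>"
    and P: "\<And>x. x \<in> \<Lambda> \<Longrightarrow> 0 \<le> P x" "(\<Sum>x\<in>\<Lambda>. P x) = 1"
    and abc: "a \<ge> 0" "b \<ge> 0" "c \<ge> 0"
    and ent: "\<And>s. select_sum s a b c \<le> - (\<Sum>x\<in>\<Lambda>. P x * log 2 (\<Sum>y\<in>{y \<in> \<Lambda>. agree s x y}. P y))"
  shows "omega_s_abc TYPE('f) a b c \<le> log 2 (asymp_support_rank TYPE('f) (mm_supp \<Lambda>))"
proof -
  let ?\<omega> = "omega_s_abc TYPE('f) a b c" and ?\<Phi> = "mm_supp \<Lambda>"
  define g where "g n = log 2 (real (support_rank TYPE('f) (mm_supp
      (mm_box (nat \<lfloor>2 powr (a * real n)\<rfloor>) (nat \<lfloor>2 powr (b * real n)\<rfloor>) (nat \<lfloor>2 powr (c * real n)\<rfloor>)))))"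
    for n
  have "\<Lambda> \<noteq> {}" using P(2) by auto
  then have \<Phi>: "finite ?\<Phi>" "?\<Phi> \<noteq> {}" using fin by (auto simp: mm_supp_eq_image)
  have R1: "support_rank TYPE('f) (supp_pow n ?\<Phi>) \<ge> 1" for n
    by (intro support_rank_pos finite_supp_pow supp_pow_nonempty \<Phi>)
  have bound: "?\<omega> \<le> log 2 (real (support_rank TYPE('f) (supp_pow m ?\<Phi>))) / real m + \<delta>"
    if m: "m \<ge> 1" and \<delta>: "\<delta> > 0" for m :: nat and \<delta> :: real
  proof -
    define r where "r = log 2 (real (support_rank TYPE('f) (supp_pow m ?\<Phi>)))"
    \<comment> \<open>5 = log 32, and (a + b + c) n + 2 is at most (a + b + c + 2) n for n \<ge>
      1.\<close>
    define C where "C = 5 + log 2 (a + b + c + 2)"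
    have step: "g (m * q) / real (m * q) \<le> r / real m + \<delta> + (C + log 2 (real (m * q))) / real (m * q)"
      if q: "q \<ge> 1" and le: "real (support_rank TYPE('f) (mm_supp (mm_box (nat \<lfloor>2 powr (a * real (m * q))\<rfloor>)
          (nat \<lfloor>2 powr (b * real (m * q))\<rfloor>) (nat \<lfloor>2 powr (c * real (m * q))\<rfloor>))))
        \<le> 32 * 2 powr (\<delta> * real (m * q)) * ((a + b + c) * real (m * q) + 2)
          * real (support_rank TYPE('f) (supp_pow (m * q) ?\<Phi>))" for q
    proof -
      define n where "n = m * q"
      have n: "n \<ge> 1" using m q by (simp add: n_def Suc_le_eq)
      let ?X = "32 * 2 powr (\<delta> * real n) * ((a + b + c + 2) * real n)
          * real (support_rank TYPE('f) (supp_pow m ?\<Phi>)) ^ q"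
      have "32 * 2 powr (\<delta> * real n) * ((a + b + c) * real n + 2) * real (support_rank TYPE('f) (supp_pow n ?\<Phi>)) \<le> ?X"
      proof (intro mult_mono)
        show "(a + b + c) * real n + 2 \<le> (a + b + c + 2) * real n" using n by (simp add: algebra_simps)
        show "real (support_rank TYPE('f) (supp_pow n ?\<Phi>)) \<le> real (support_rank TYPE('f) (supp_pow m ?\<Phi>)) ^ q"
          using support_rank_supp_pow_mult[OF \<Phi>(1) q, of m, where 'f = 'f]
          unfolding n_def by (metis of_nat_le_iff of_nat_power)
      qed (use abc in auto)
      with le have "real (support_rank TYPE('f) (mm_supp (mm_box (nat \<lfloor>2 powr (a * real n)\<rfloor>)
          (nat \<lfloor>2 powr (b * real n)\<rfloor>) (nat \<lfloor>2 powr (c * real n)\<rfloor>)))) \<le> ?X"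
        unfolding n_def by linarith
      moreover have "support_rank TYPE('f) (mm_supp (mm_box (nat \<lfloor>2 powr (a * real n)\<rfloor>)
          (nat \<lfloor>2 powr (b * real n)\<rfloor>) (nat \<lfloor>2 powr (c * real n)\<rfloor>))) \<ge> 1"
        by (intro support_rank_mm_box_pos floor_powr_bounds abc)
      ultimately have "g n \<le> log 2 ?X" unfolding g_def by (intro log_mono) auto
      also have "\<dots> = C + log 2 (real n) + \<delta> * real n + real q * r"
      proof -
        have "log 2 (32 :: real) = 5" using log_nat_power[of 2 2 5] by simp
        moreover have "a + b + c + 2 > 0" "real n > 0" "real (support_rank TYPE('f) (supp_pow m ?\<Phi>)) > 0"
          using abc n R1[of m] by auto
        ultimately show ?thesis by (simp add: log_mult log_nat_power C_def r_def)
      qed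
      finally have "g n / real n \<le> (C + log 2 (real n) + \<delta> * real n + real q * r) / real n"
        by (intro divide_right_mono) auto
      also have "\<dots> = r / real m + \<delta> + (C + log 2 (real n)) / real n"
      proof -
        have "real q * r / real n = r / real m" using q by (simp add: n_def)
        then show ?thesis using n by (simp add: add_divide_distrib)
      qed
      finally show ?thesis by (simp only: n_def)
    qed
    have sub: "filterlim (\<lambda>q. m * q) sequentially sequentially"
      using m by (intro filterlim_subseq) (auto simp: strict_mono_def)
    have lim1: "(\<lambda>q. g (m * q) / real (m * q)) \<longlonglongrightarrow> ?\<omega>"
      using filterlim_compose[OF omega_s_abc_LIMSEQ[OF abc, where 'f = 'f] sub] by (simp only: g_def)
    have "(\<lambda>n. r / real m + \<delta> + (C + log 2 (real n)) / real n) \<longlonglongrightarrow> r / real m + \<delta> + 0"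
      by (intro tendsto_add tendsto_const) real_asymp
    from filterlim_compose[OF this sub]
    have lim2: "(\<lambda>q. r / real m + \<delta> + (C + log 2 (real (m * q))) / real (m * q)) \<longlonglongrightarrow> r / real m + \<delta>"
      by simp
    have "\<forall>\<^sub>F q in sequentially. g (m * q) / real (m * q)
        \<le> r / real m + \<delta> + (C + log 2 (real (m * q))) / real (m * q)"
    proof -
      have "\<forall>\<^sub>F n :: nat in sequentially. real (support_rank TYPE('f) (mm_supp
          (mm_box (nat \<lfloor>2 powr (a * real n)\<rfloor>) (nat \<lfloor>2 powr (b * real n)\<rfloor>) (nat \<lfloor>2 powr (c * real n)\<rfloor>))))
        \<le> 32 * 2 powr (\<delta> * real n) * ((a + b + c) * real n + 2) * real (support_rank TYPE('f) (supp_pow n ?\<Phi>))"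
        by (rule support_rank_mm_box_le[OF inf fin _ P(2) abc ent \<delta>]) (rule P(1))
      from eventually_compose_filterlim[OF this sub] eventually_ge_at_top[of 1]
      show ?thesis by eventually_elim (rule step)
    qed
    from tendsto_le[OF _ lim2 lim1 this] show ?thesis by (simp add: r_def)
  qed
  have "2 powr ?\<omega> \<le> asymp_support_rank TYPE('f) ?\<Phi>"
  proof (rule asymp_support_rank_ge)
    fix m :: nat assume m: "m \<ge> 1"
    let ?R = "real (support_rank TYPE('f) (supp_pow m ?\<Phi>))"
    have "?\<omega> \<le> log 2 ?R / real m" by (rule field_le_epsilon) (rule bound[OF m])
    then have "2 powr ?\<omega> \<le> 2 powr (log 2 ?R / real m)" by simp
    also have "\<dots> = (2 powr log 2 ?R) powr (1 / real m)" by (simp add: powr_powr)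
    also have "\<dots> = ?R powr (1 / real m)" using R1[of m] by simp
    finally show "2 powr ?\<omega> \<le> ?R powr (1 / real m)" .
  qed
  then have "log 2 (2 powr ?\<omega>) \<le> log 2 (asymp_support_rank TYPE('f) ?\<Phi>)"
    by (intro log_mono) auto
  then show ?thesis by simp
qed

subsection \<open>Entropy\<close>

text \<open>All marginal entropies become sums over the same set \<Lambda>, so they can be compared
  term by term.\<close>

lemma marg_entropy_eq:
  assumes "finite \<Lambda>"
  shows "marg_entropy \<Lambda> P f = - (\<Sum>x\<in>\<Lambda>. P x * log 2 (\<Sum>y\<in>{y \<in> \<Lambda>. f y = f x}. P y))"
proof -
  have "(\<Sum>x\<in>\<Lambda>. P x * log 2 (\<Sum>y\<in>{y \<in> \<Lambda>. f y = f x}. P y))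
      = (\<Sum>z\<in>f ` \<Lambda>. \<Sum>x\<in>{x \<in> \<Lambda>. f x = z}. P x * log 2 (\<Sum>y\<in>{y \<in> \<Lambda>. f y = f x}. P y))"
    by (rule sum.image_gen[OF assms])
  also have "\<dots> = (\<Sum>z\<in>f ` \<Lambda>. (\<Sum>x\<in>{x \<in> \<Lambda>. f x = z}. P x) * log 2 (\<Sum>x\<in>{x \<in> \<Lambda>. f x = z}. P x))"
    by (intro sum.cong refl) (auto simp: sum_distrib_right intro!: sum.cong)
  finally show ?thesis by (simp add: marg_entropy_def)
qed

lemma marg_entropy_mono:
  assumes fin: "finite \<Lambda>" and P: "\<And>x. x \<in> \<Lambda> \<Longrightarrow> 0 < P x"
    and ref: "\<And>x y. x \<in> \<Lambda> \<Longrightarrow> y \<in> \<Lambda> \<Longrightarrow> g x = g y \<Longrightarrow> f x = f y"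
  shows "marg_entropy \<Lambda> P f \<le> marg_entropy \<Lambda> P g"
  unfolding marg_entropy_eq[OF fin] neg_le_iff_le
proof (intro sum_mono mult_left_mono)
  fix x assume x: "x \<in> \<Lambda>"
  have P0: "0 \<le> P y" if "y \<in> \<Lambda>" for y using P[OF that] by simp
  have "P x \<le> (\<Sum>y\<in>{y \<in> \<Lambda>. g y = g x}. P y)" using x fin P0 by (intro member_le_sum) auto
  moreover have "(\<Sum>y\<in>{y \<in> \<Lambda>. g y = g x}. P y) \<le> (\<Sum>y\<in>{y \<in> \<Lambda>. f y = f x}. P y)"
  proof (rule sum_mono2)
    show "{y \<in> \<Lambda>. g y = g x} \<subseteq> {y \<in> \<Lambda>. f y = f x}" using ref x by blast
  qed (use fin P0 in auto)
  ultimately show "log 2 (\<Sum>y\<in>{y \<in> \<Lambda>. g y = g x}. P y) \<le> log 2 (\<Sum>y\<in>{y \<in> \<Lambda>. f y = f x}. P y)"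
    using P[OF x] by (intro log_mono) auto
  show "0 \<le> P x" by (rule P0[OF x])
qed

text \<open>Conditional mutual information is nonnegative: both v and w determine u, and z is the
  pair of v and w. The proof uses ln x \<le> x - 1 for the ratio cv cw / (cz cu), whose mean is at
  most 1.\<close>

lemma marg_entropy_submodular:
  assumes fin: "finite \<Lambda>" and P: "\<And>x. x \<in> \<Lambda> \<Longrightarrow> 0 < P x" "(\<Sum>x\<in>\<Lambda>. P x) = 1"
    and vu: "\<And>x y. v x = v y \<Longrightarrow> u x = u y" and wu: "\<And>x y. w x = w y \<Longrightarrow> u x = u y"
    and z: "\<And>x y. z x = z y \<longleftrightarrow> v x = v y \<and> w x = w y"
  shows "marg_entropy \<Lambda> P z + marg_entropy \<Lambda> P u \<le> marg_entropy \<Lambda> P v + marg_entropy \<Lambda> P w"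
proof -
  have P0: "0 \<le> P y" if "y \<in> \<Lambda>" for y using P(1)[OF that] by simp
  define cu cv cw cz where "cu x = (\<Sum>y\<in>{y \<in> \<Lambda>. u y = u x}. P y)" and "cv x = (\<Sum>y\<in>{y \<in> \<Lambda>. v y = v x}. P y)"
    and "cw x = (\<Sum>y\<in>{y \<in> \<Lambda>. w y = w x}. P y)" and "cz x = (\<Sum>y\<in>{y \<in> \<Lambda>. z y = z x}. P y)" for x
  have pos: "cu x > 0" "cv x > 0" "cw x > 0" "cz x > 0" if "x \<in> \<Lambda>" for x
    unfolding cu_def cv_def cw_def cz_def
    using that fin P by (auto intro!: sum_pos)
  \<comment> \<open>The points with the v-class of y and the w-class of y' are either none or one
    full z-class. In the latter case u agrees at y and y', and the sum collapses to 1 / cu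
    y.\<close>
  define inner where "inner y y' = (\<Sum>x\<in>{x \<in> \<Lambda>. v x = v y \<and> w x = w y'}. P x / (cz x * cu x))" for y y'
  have inner: "inner y y' \<le> of_bool (u y' = u y) / cu y" if "y \<in> \<Lambda>" "y' \<in> \<Lambda>" for y y'
  proof (cases "\<exists>x\<in>\<Lambda>. v x = v y \<and> w x = w y'")
    case True
    then obtain x0 where x0: "x0 \<in> \<Lambda>" "v x0 = v y" "w x0 = w y'" by blast
    have u: "u x0 = u y" "u x0 = u y'" using x0 vu wu by blast+
    have "{x \<in> \<Lambda>. v x = v y \<and> w x = w y'} = {x \<in> \<Lambda>. z x = z x0}" using x0 z by auto
    then have "inner y y' = (\<Sum>x\<in>{x \<in> \<Lambda>. z x = z x0}. P x / (cz x * cu x))" by (simp add: inner_def)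
    also have "\<dots> = (\<Sum>x\<in>{x \<in> \<Lambda>. z x = z x0}. P x / (cz x0 * cu y))"
    proof (intro sum.cong refl)
      fix x assume "x \<in> {x \<in> \<Lambda>. z x = z x0}"
      then have zx: "z x = z x0" by simp
      then have "v x = v x0" unfolding z by simp
      then have "u x = u y" using vu[of x x0] u(1) by simp
      with zx show "P x / (cz x * cu x) = P x / (cz x0 * cu y)" by (simp add: cz_def cu_def)
    qed
    also have "\<dots> = cz x0 / (cz x0 * cu y)" by (simp add: cz_def sum_divide_distrib)
    also have "\<dots> = 1 / cu y" using pos(4)[OF x0(1)] by simp
    finally show ?thesis using u by simp
  next
    case False
    then have "inner y y' = 0" unfolding inner_def by (intro sum.neutral) blast
    then show ?thesis using pos(1)[OF that(1)] by simp
  qed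
  have filt: "(\<Sum>y\<in>{y \<in> \<Lambda>. A y}. h y) = (\<Sum>y\<in>\<Lambda>. h y * of_bool (A y))" for A and h :: "'a \<Rightarrow> real"
    using fin by (intro sum.mono_neutral_cong_left) auto
  \<comment> \<open>Writing cv and cw as sums over y and y' lets the sum over x be carried out
    first, where \<open>inner\<close> applies.\<close>
  have "(\<Sum>x\<in>\<Lambda>. P x * (cv x * cw x / (cz x * cu x)))
      = (\<Sum>x\<in>\<Lambda>. \<Sum>y\<in>\<Lambda>. \<Sum>y'\<in>\<Lambda>. P y * P y' * (P x / (cz x * cu x) * of_bool (v x = v y \<and> w x = w y')))"
  proof (intro sum.cong refl)
    fix x
    have "cv x * cw x = (\<Sum>y\<in>\<Lambda>. \<Sum>y'\<in>\<Lambda>. (P y * of_bool (v y = v x)) * (P y' * of_bool (w y' = w x)))"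
      by (simp only: cv_def cw_def filt sum_product)
    then have "P x * (cv x * cw x / (cz x * cu x)) = (P x / (cz x * cu x)) *
      (\<Sum>y\<in>\<Lambda>. \<Sum>y'\<in>\<Lambda>. (P y * of_bool (v y = v x)) * (P y' * of_bool (w y' = w x)))" by simp
    also have "\<dots> = (\<Sum>y\<in>\<Lambda>. \<Sum>y'\<in>\<Lambda>. P y * P y' * (P x / (cz x * cu x) * of_bool (v x = v y \<and> w x = w y')))"
      unfolding sum_distrib_left by (intro sum.cong refl) auto
    finally show "P x * (cv x * cw x / (cz x * cu x)) = \<dots>" .
  qed
  also have "\<dots> = (\<Sum>y\<in>\<Lambda>. \<Sum>x\<in>\<Lambda>. \<Sum>y'\<in>\<Lambda>. P y * P y' * (P x / (cz x * cu x) * of_bool (v x = v y \<and> w x = w y')))"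
    by (rule sum.swap)
  also have "\<dots> = (\<Sum>y\<in>\<Lambda>. \<Sum>y'\<in>\<Lambda>. \<Sum>x\<in>\<Lambda>. P y * P y' * (P x / (cz x * cu x) * of_bool (v x = v y \<and> w x = w y')))"
    by (intro sum.cong refl sum.swap)
  also have "\<dots> = (\<Sum>y\<in>\<Lambda>. \<Sum>y'\<in>\<Lambda>. P y * P y' * inner y y')"
    by (simp only: inner_def filt sum_distrib_left)
  also have "\<dots> \<le> (\<Sum>y\<in>\<Lambda>. \<Sum>y'\<in>\<Lambda>. P y * P y' * (of_bool (u y' = u y) / cu y))"
    using P0 by (intro sum_mono mult_left_mono inner mult_nonneg_nonneg) auto
  also have "\<dots> = (\<Sum>y\<in>\<Lambda>. P y)"
  proof (intro sum.cong refl)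
    fix y assume y: "y \<in> \<Lambda>"
    have "(\<Sum>y'\<in>\<Lambda>. P y * P y' * (of_bool (u y' = u y) / cu y)) = P y / cu y * (\<Sum>y'\<in>\<Lambda>. P y' * of_bool (u y' = u y))"
      unfolding sum_distrib_left by (intro sum.cong) auto
    also have "\<dots> = P y / cu y * cu y" by (simp only: cu_def filt)
    finally show "(\<Sum>y'\<in>\<Lambda>. P y * P y' * (of_bool (u y' = u y) / cu y)) = P y" using pos[OF y] by simp
  qed
  finally have key: "(\<Sum>x\<in>\<Lambda>. P x * (cv x * cw x / (cz x * cu x))) \<le> 1" using P by simp
  have "(\<Sum>x\<in>\<Lambda>. P x * (ln (cv x) + ln (cw x) - ln (cz x) - ln (cu x)))
      \<le> (\<Sum>x\<in>\<Lambda>. P x * (cv x * cw x / (cz x * cu x) - 1))"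
  proof (intro sum_mono mult_left_mono)
    fix x assume x: "x \<in> \<Lambda>"
    have "ln (cv x * cw x / (cz x * cu x)) \<le> cv x * cw x / (cz x * cu x) - 1"
      using pos[OF x] by (intro ln_le_minus_one) auto
    then show "ln (cv x) + ln (cw x) - ln (cz x) - ln (cu x) \<le> cv x * cw x / (cz x * cu x) - 1"
      using pos[OF x] by (simp add: ln_div ln_mult)
  qed (rule P0)
  also have "\<dots> = (\<Sum>x\<in>\<Lambda>. P x * (cv x * cw x / (cz x * cu x))) - (\<Sum>x\<in>\<Lambda>. P x)"
    by (simp only: right_diff_distrib sum_subtractf mult_1_right)
  also have "\<dots> \<le> 0" using key P by simp
  finally have "(\<Sum>x\<in>\<Lambda>. P x * (ln (cv x) + ln (cw x) - ln (cz x) - ln (cu x))) / ln 2 \<le> 0"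
    by (simp add: divide_nonpos_pos)
  also have "(\<Sum>x\<in>\<Lambda>. P x * (ln (cv x) + ln (cw x) - ln (cz x) - ln (cu x))) / ln 2
      = (\<Sum>x\<in>\<Lambda>. P x * log 2 (cv x)) + (\<Sum>x\<in>\<Lambda>. P x * log 2 (cw x))
        - (\<Sum>x\<in>\<Lambda>. P x * log 2 (cz x)) - (\<Sum>x\<in>\<Lambda>. P x * log 2 (cu x))"
    unfolding sum_divide_distrib sum.distrib[symmetric] sum_subtractf[symmetric]
    by (intro sum.cong refl) (simp add: log_def diff_divide_distrib add_divide_distrib algebra_simps)
  finally show ?thesis
    unfolding marg_entropy_eq[OF fin] cu_def cv_def cw_def cz_def by linarith
qed

text \<open>Seven of the eight choices of s are the given inequalities; for the empty choice the
  right-hand side is 0, as the total mass is 1.\<close>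

lemma agree_entropy_bound:
  fixes P :: "'i \<times> 'j \<times> 'k \<Rightarrow> real"
  assumes fin: "finite \<Lambda>" and P: "(\<Sum>x\<in>\<Lambda>. P x) = 1"
    and ent: "a \<le> marg_entropy \<Lambda> P (\<lambda>(i, j, k). i)" "b \<le> marg_entropy \<Lambda> P (\<lambda>(i, j, k). j)"
      "c \<le> marg_entropy \<Lambda> P (\<lambda>(i, j, k). k)" "a + b \<le> marg_entropy \<Lambda> P (\<lambda>(i, j, k). (i, j))"
      "a + c \<le> marg_entropy \<Lambda> P (\<lambda>(i, j, k). (i, k))" "b + c \<le> marg_entropy \<Lambda> P (\<lambda>(i, j, k). (j, k))"
      "a + b + c \<le> marg_entropy \<Lambda> P (\<lambda>x. x)"
  shows "select_sum s a b c \<le> - (\<Sum>x\<in>\<Lambda>. P x * log 2 (\<Sum>y\<in>{y \<in> \<Lambda>. agree s x y}. P y))"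
proof -
  let ?R = "\<lambda>s. - (\<Sum>x\<in>\<Lambda>. P x * log 2 (\<Sum>y\<in>{y \<in> \<Lambda>. agree s x y}. P y))"
  have *: "marg_entropy \<Lambda> P f = - (\<Sum>x\<in>\<Lambda>. P x * log 2 (\<Sum>y\<in>{y \<in> \<Lambda>. agree s x y}. P y))"
    if "\<And>x y. f y = f x \<longleftrightarrow> agree s x y" for f :: "'i \<times> 'j \<times> 'k \<Rightarrow> 'y" and s
    unfolding marg_entropy_eq[OF fin] that ..
  obtain s1 s2 s3 where s: "s = (s1, s2, s3)" by (metis prod_cases3)
  have "0 \<le> ?R (False, False, False)"
    using P by (simp add: agree_def)
  moreover have "marg_entropy \<Lambda> P (\<lambda>(i, j, k). i) = ?R (True, False, False)"
    "marg_entropy \<Lambda> P (\<lambda>(i, j, k). j) = ?R (False, True, False)"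
    "marg_entropy \<Lambda> P (\<lambda>(i, j, k). k) = ?R (False, False, True)"
    "marg_entropy \<Lambda> P (\<lambda>(i, j, k). (i, j)) = ?R (True, True, False)"
    "marg_entropy \<Lambda> P (\<lambda>(i, j, k). (i, k)) = ?R (True, False, True)"
    "marg_entropy \<Lambda> P (\<lambda>(i, j, k). (j, k)) = ?R (False, True, True)"
    "marg_entropy \<Lambda> P (\<lambda>x. x) = ?R (True, True, True)"
    by (rule *; auto simp: agree_def)+
  ultimately show ?thesis
    using ent unfolding s by (cases s1; cases s2; cases s3) (simp_all add: select_sum_def)
qed

lemma omega_s_abc_le:
  fixes \<Lambda> :: "('i \<times> 'j \<times> 'k) set" and P :: "'i \<times> 'j \<times> 'k \<Rightarrow> real"
  assumes inf: "infinite (UNIV :: 'f::field set)" and fin: "finite \<Lambda>"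
    and P: "\<And>x. x \<in> \<Lambda> \<Longrightarrow> 0 \<le> P x" "(\<Sum>x\<in>\<Lambda>. P x) = 1"
    and abc: "a \<ge> 0" "b \<ge> 0" "c \<ge> 0"
    and ent: "a \<le> marg_entropy \<Lambda> P (\<lambda>(i, j, k). i)" "b \<le> marg_entropy \<Lambda> P (\<lambda>(i, j, k). j)"
      "c \<le> marg_entropy \<Lambda> P (\<lambda>(i, j, k). k)" "a + b \<le> marg_entropy \<Lambda> P (\<lambda>(i, j, k). (i, j))"
      "a + c \<le> marg_entropy \<Lambda> P (\<lambda>(i, j, k). (i, k))" "b + c \<le> marg_entropy \<Lambda> P (\<lambda>(i, j, k). (j, k))"
      "a + b + c \<le> marg_entropy \<Lambda> P (\<lambda>x. x)"
  shows "omega_s_abc TYPE('f) a b c \<le> log 2 (asymp_support_rank TYPE('f) (mm_supp \<Lambda>))"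
  by (rule omega_s_abc_le_log_asymp[OF inf fin _ P(2) abc agree_entropy_bound[OF fin P(2) ent]])
    (rule P(1))

lemma log_asymp_le_log_border:
  assumes inf: "infinite (UNIV :: 'f::field set)" and \<Phi>: "finite \<Phi>" "\<Phi> \<noteq> {}"
  shows "log 2 (asymp_support_rank TYPE('f) \<Phi>) \<le> log 2 (real (border_support_rank TYPE('f) \<Phi>))"
    and "log 2 (real (border_support_rank TYPE('f) \<Phi>)) \<le> log 2 (real (support_rank TYPE('f) \<Phi>))"
proof -
  have "1 \<le> asymp_support_rank TYPE('f) \<Phi>" by (rule asymp_support_rank_ge_1[OF \<Phi>])
  moreover have "asymp_support_rank TYPE('f) \<Phi> \<le> real (border_support_rank TYPE('f) \<Phi>)"
    by (rule asymp_support_rank_le_border[OF inf \<Phi>(1)])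
  moreover have "real (border_support_rank TYPE('f) \<Phi>) \<le> real (support_rank TYPE('f) \<Phi>)"
    using border_support_rank_le[OF \<Phi>(1)] by (rule of_nat_mono)
  ultimately show "log 2 (asymp_support_rank TYPE('f) \<Phi>) \<le> log 2 (real (border_support_rank TYPE('f) \<Phi>))"
    "log 2 (real (border_support_rank TYPE('f) \<Phi>)) \<le> log 2 (real (support_rank TYPE('f) \<Phi>))"
    by (intro log_mono; linarith)+
qed

text \<open>For the uniform distribution the point \<open>(H(I), H(IJ) - H(I), H(IJK) - H(IJ))\<close> satisfies all
  entropy constraints by submodularity, and its coordinates add up to \<open>log |\<Lambda>|\<close>.\<close>

lemma omega_s_le_log_support_rank:
  fixes \<Lambda> :: "('i \<times> 'j \<times> 'k) set"
  assumes inf: "infinite (UNIV :: 'f::field set)" and fin: "finite \<Lambda>" and ne: "\<Lambda> \<noteq> {}"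
  shows "omega_s TYPE('f) * log 2 (real (card \<Lambda>)) \<le> 3 * log 2 (real (support_rank TYPE('f) (mm_supp \<Lambda>)))"
proof -
  have card: "real (card \<Lambda>) > 0" using fin ne by (simp add: card_gt_0_iff)
  define P :: "'i \<times> 'j \<times> 'k \<Rightarrow> real" where "P = (\<lambda>_. 1 / card \<Lambda>)"
  have P: "\<And>x. x \<in> \<Lambda> \<Longrightarrow> 0 < P x" "(\<Sum>x\<in>\<Lambda>. P x) = 1" using card by (auto simp: P_def)
  let ?H = "\<lambda>f. marg_entropy \<Lambda> P f"
  let ?i = "\<lambda>(i, j, k). i" and ?j = "\<lambda>(i, j, k). j" and ?k = "\<lambda>(i, j, k). k"
  let ?ij = "\<lambda>(i, j, k). (i, j)" and ?ik = "\<lambda>(i, j, k). (i, k)" and ?jk = "\<lambda>(i, j, k). (j, k)"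
  define hi hj hk hij hik hjk h0 h where "hi = ?H ?i" and "hj = ?H ?j" and "hk = ?H ?k"
    and "hij = ?H ?ij" and "hik = ?H ?ik" and "hjk = ?H ?jk" and "h0 = ?H (\<lambda>_. ())" and "h = ?H (\<lambda>x. x)"
  note h_defs = hi_def hj_def hk_def hij_def hik_def hjk_def h0_def h_def
  have h0: "h0 = 0" unfolding h_defs marg_entropy_eq[OF fin] by (simp add: P)
  have h: "h = log 2 (card \<Lambda>)"
  proof -
    have "{y \<in> \<Lambda>. y = x} = {x}" if "x \<in> \<Lambda>" for x using that by auto
    then have "h = - (\<Sum>x\<in>\<Lambda>. P x * log 2 (P x))"
      unfolding h_defs marg_entropy_eq[OF fin] by (intro arg_cong[where f = uminus] sum.cong) auto
    also have "\<dots> = log 2 (card \<Lambda>)" using card by (simp add: P_def log_divide)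
    finally show ?thesis .
  qed
  have mono: "h0 \<le> hi" "hi \<le> hij" "hij \<le> h"
    unfolding h_defs by (intro marg_entropy_mono[OF fin P(1)]; auto)+
  \<comment> \<open>With h0 = 0 these give, in this order, the constraints for J, K, IK and JK;
    those for I, IJ and IJK hold with equality.\<close>
  have sub: "hij + h0 \<le> hi + hj" "h + h0 \<le> hij + hk" "h + hi \<le> hij + hik" "h + h0 \<le> hi + hjk"
    unfolding h_defs by (intro marg_entropy_submodular[OF fin P]; auto)+
  \<comment> \<open>The greedy vertex of the entropy polymatroid for the order I, J, K.\<close>
  define a b c where "a = hi" and "b = hij - hi" and "c = h - hij"
  have abc: "a \<ge> 0" "b \<ge> 0" "c \<ge> 0" using mono h0 by (auto simp: a_def b_def c_def)
  have "a \<le> hi" "b \<le> hj" "c \<le> hk" "a + b \<le> hij" "a + c \<le> hik" "b + c \<le> hjk" "a + b + c \<le> h"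
    using sub h0 by (auto simp: a_def b_def c_def)
  then have "omega_s_abc TYPE('f) a b c \<le> log 2 (asymp_support_rank TYPE('f) (mm_supp \<Lambda>))"
    using P abc unfolding h_defs by (intro omega_s_abc_le[OF inf fin, of P]) (auto intro: less_imp_le)
  also have "\<dots> \<le> log 2 (real (support_rank TYPE('f) (mm_supp \<Lambda>)))"
  proof -
    have "finite (mm_supp \<Lambda>)" "mm_supp \<Lambda> \<noteq> {}" using fin ne by (auto simp: mm_supp_eq_image)
    from log_asymp_le_log_border[OF inf this] show ?thesis by linarith
  qed
  finally have "3 * omega_s_abc TYPE('f) a b c \<le> 3 * log 2 (real (support_rank TYPE('f) (mm_supp \<Lambda>)))" by simp
  moreover have "omega_s TYPE('f) * (a + b + c) \<le> 3 * omega_s_abc TYPE('f) a b c"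
    by (rule omega_s_le_omega_s_abc[OF abc])
  moreover have "a + b + c = log 2 (card \<Lambda>)" by (simp add: a_def b_def c_def h)
  ultimately show ?thesis by simp
qed

text \<open>The last bound is multiplied out because the logarithm of the size of a one-point
  \<Lambda> is 0.\<close>

theorem theorem4p9:
  fixes I :: "'i set" and J :: "'j set" and K :: "'k set"
    and \<Lambda> :: "('i \<times> 'j \<times> 'k) set"
  assumes infF: "infinite (UNIV :: 'f::field set)"
    and fin: "finite I" "finite J" "finite K"
    and sub: "\<Lambda> \<subseteq> I \<times> J \<times> K" and ne: "\<Lambda> \<noteq> {}"
  shows "(\<forall>(P :: 'i \<times> 'j \<times> 'k \<Rightarrow> real) a b c.
           (\<forall>x\<in>\<Lambda>. 0 \<le> P x) \<and> (\<Sum>x\<in>\<Lambda>. P x) = 1 \<and> 0 \<le> a \<and> 0 \<le> b \<and> 0 \<le> c \<and>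
           a \<le> marg_entropy \<Lambda> P (\<lambda>(i, j, k). i) \<and>
           b \<le> marg_entropy \<Lambda> P (\<lambda>(i, j, k). j) \<and>
           c \<le> marg_entropy \<Lambda> P (\<lambda>(i, j, k). k) \<and>
           a + b \<le> marg_entropy \<Lambda> P (\<lambda>(i, j, k). (i, j)) \<and>
           a + c \<le> marg_entropy \<Lambda> P (\<lambda>(i, j, k). (i, k)) \<and>
           b + c \<le> marg_entropy \<Lambda> P (\<lambda>(i, j, k). (j, k)) \<and>
           a + b + c \<le> marg_entropy \<Lambda> P (\<lambda>x. x)
         \<longrightarrow>
           omega_s_abc TYPE('f) a b c \<le> log 2 (asymp_support_rank TYPE('f) (mm_supp \<Lambda>)) \<and>
           log 2 (asymp_support_rank TYPE('f) (mm_supp \<Lambda>))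
             \<le> log 2 (real (border_support_rank TYPE('f) (mm_supp \<Lambda>))) \<and>
           log 2 (real (border_support_rank TYPE('f) (mm_supp \<Lambda>)))
             \<le> log 2 (real (support_rank TYPE('f) (mm_supp \<Lambda>))))
       \<and> omega_s TYPE('f) * log 2 (real (card \<Lambda>))
           \<le> 3 * log 2 (real (support_rank TYPE('f) (mm_supp \<Lambda>)))"
proof (intro conjI allI impI)
  have fin\<Lambda>: "finite \<Lambda>" by (rule finite_subset[OF sub]) (use fin in simp)
  have \<Phi>: "finite (mm_supp \<Lambda>)" "mm_supp \<Lambda> \<noteq> {}" using fin\<Lambda> ne by (auto simp: mm_supp_eq_image)
  show "log 2 (asymp_support_rank TYPE('f) (mm_supp \<Lambda>)) \<le> log 2 (real (border_support_rank TYPE('f) (mm_supp \<Lambda>)))"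
    "log 2 (real (border_support_rank TYPE('f) (mm_supp \<Lambda>))) \<le> log 2 (real (support_rank TYPE('f) (mm_supp \<Lambda>)))"
    by (rule log_asymp_le_log_border[OF infF \<Phi>])+
  show "omega_s TYPE('f) * log 2 (real (card \<Lambda>)) \<le> 3 * log 2 (real (support_rank TYPE('f) (mm_supp \<Lambda>)))"
    by (rule omega_s_le_log_support_rank[OF infF fin\<Lambda> ne])
qed (elim conjE, rule omega_s_abc_le[OF infF finite_subset[OF sub]], use fin in auto)

end
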